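(* Let $n\ge1$. If two finite dimensional cyclic $\mathfrak{sl}(n+1)\ltimes\mathbb{C}^{n+1}$-modules $V$ and $W$, generated respectively by $\mathfrak{sl}(n+1)$-highest weight vectors $v_{\mu_0}$ and $w_{\nu_0}$ of weights $\mu_0$ and $\nu_0$, are equivalent (isomorphic), then the sets $\mathcal{J}(V)$ and $\mathcal{J}(W)$ coincide.
   Context: Everything is over $\mathbb{C}$ and all modules are finite dimensional. $A_{i,j}$ denotes a matrix unit. In $\mathfrak{sl}(n+1)$ put $E_{p,q}=A_{p,q+1}$, $F_{p,q}=A_{q+1,p}$ for $1\le p\le q\le n$, $H_i=A_{i,i}-A_{i+1,i+1}$, $F_i=F_{i,i}$. $\mathfrak{g}=\mathfrak{sl}(n+1)\ltimes\mathbb{C}^{n+1}$ is the semidirect sum of $\mathfrak{sl}(n+1)$ with its standard representation $\mathfrak{p}=\mathbb{C}^{n+1}$ (an abelian ideal), with standard basis $P_1,\dots,P_{n+1}$, so $[X,P_j]=XP_j$ for $X\in\mathfrak{sl}(n+1)$. $\omega_1,\dots,\omega_n$ are the fundamental weights of $\mathfrak{sl}(n+1)$ ($\omega_i(H_j)=\delta_{ij}$), $\omega_0=\omega_{n+1}=0$. A highest weight vector of weight $\mu=\sum_i\mu_i\omega_i$ is a nonzero vector $v$ with $H_iv=\mu_iv$ and $E_{p,q}v=0$ for all $i,p,q$. $V$ is cyclic with generator $v$ if $V=\mathcal{U}(\mathfrak{g})v$. Maps $\varphi_i$. For an integral weight $\mu=\sum\mu_i\omega_i$ and $1\le k\le s\le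 n$ put $\mu_{k,s}=-\sum_{i=k}^s(\mu_i+1)$; $P_i^{(\mu(s))}=\bigl(\prod_{k=1}^{i-1}\mu_{k,s-1}\bigr)P_i$ for $1\le i\le s\le n+1$; $F_{i,j}^{(\mu(s))}=\bigl(\prod_{k=i+1}^{j}\mu_{k,s}\bigr)F_{i,j}$ for $1\le i\le j\le s\le n$ (empty products are $1$); and define $Q^{(\mu(s))}_k\in\mathcal{U}(\mathfrak{sl}(n+1))$ by $Q^{(\mu(s))}_{s+1}=1$, $Q^{(\mu(s))}_{k}=\sum_{l=k}^{s}Q^{(\mu(s))}_{l+1}F^{(\mu(s))}_{k,l}$ for $1\le k\le s$. For a highest weight vector $v_\mu$ of weight $\mu$ in a $\mathfrak{g}$-module, $\varphi_i(v_\mu)=P^{(\mu(i))}_iv_\mu+\sum_{k=1}^{i-1}Q^{(\mu(i-1))}_kP^{(\mu(i))}_kv_\mu$, $1\le i\le n+1$. Each $\varphi_i(v_\mu)$ is zero or a highest weight vector of weight $\mu+\omega_i-\omega_{i-1}$, so the $\varphi_i$ can be iterated (each time using the weight of the current vector), with $\varphi_i(0)=0$. The set $\mathcal{J}(V)$. Let $V$ be cyclic, generated by a highest weight vector $v_{\mu_0}$ of weight $\mu_0$. Let $J_1$ be the smallest positive integer with $\varphi_1^{J_1}(v_{\mu_0})=0$; recursively, for $2\le k\le n+1$ and integers $0\le i_1<J_1$, $0\le i_h<J_h(i_1,\dots,i_{h-1})$ $(2\le h\le k-1)$, let $J_k(i_1,\dots,i_{k-1})$ be the smallest positive integer $J$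 with $\varphi_k^{J}(\varphi_{k-1}^{i_{k-1}}(\cdots\varphi_1^{i_1}(v_{\mu_0})\cdots))=0$. $\mathcal{J}(V)$ consists of $\mu_0$ together with the indexed family of integers $J_1$, $J_k(i_1,\dots,i_{k-1})$ $(2\le k\le n+1)$ (computed with the given generator); coincidence means equal weights and equal indexed families. *)

theory Defs
  imports Complex_Main "Jordan_Normal_Form.Matrix"
begin

text \<open>Elements of $sl(n+1) \ltimes C^{n+1}$ are pairs of a traceless matrix and a vector. Matrix
  and vector entries are numbered from 0 in the matrix library; the definitions below take the
  indices $1, \dots, n+1$.\<close>

type_synonym gelem = "complex mat \<times> complex vec"

definition g_carrier :: "nat \<Rightarrow> gelem set" where
  "g_carrier n = {(X, p). X \<in> carrier_mat (n + 1) (n + 1) \<and> (\<Sum>i<n + 1. X $$ (i, i)) = 0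
                        \<and> p \<in> carrier_vec (n + 1)}"

definition sl_carrier :: "nat \<Rightarrow> gelem set" where
  "sl_carrier n = {(X, p) \<in> g_carrier n. p = 0\<^sub>v (n + 1)}"

definition g_add :: "gelem \<Rightarrow> gelem \<Rightarrow> gelem" where
  "g_add x y = (fst x + fst y, snd x + snd y)"

definition g_scale :: "complex \<Rightarrow> gelem \<Rightarrow> gelem" where
  "g_scale c x = (c \<cdot>\<^sub>m fst x, c \<cdot>\<^sub>v snd x)"

definition g_bracket :: "gelem \<Rightarrow> gelem \<Rightarrow> gelem" where
  "g_bracket x y = (fst x * fst y - fst y * fst x, fst x *\<^sub>v snd y - fst y *\<^sub>v snd x)"

definition mat_unit :: "nat \<Rightarrow> nat \<Rightarrow> nat \<Rightarrow> complex mat" where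
  "mat_unit n i j = mat (n + 1) (n + 1) (\<lambda>(a, b). if a + 1 = i \<and> b + 1 = j then 1 else 0)"

definition gE :: "nat \<Rightarrow> nat \<Rightarrow> nat \<Rightarrow> gelem" where
  "gE n p q = (mat_unit n p (q + 1), 0\<^sub>v (n + 1))"

definition gF :: "nat \<Rightarrow> nat \<Rightarrow> nat \<Rightarrow> gelem" where
  "gF n p q = (mat_unit n (q + 1) p, 0\<^sub>v (n + 1))"

definition gH :: "nat \<Rightarrow> nat \<Rightarrow> gelem" where
  "gH n i = (mat_unit n i i - mat_unit n (i + 1) (i + 1), 0\<^sub>v (n + 1))"

definition gP :: "nat \<Rightarrow> nat \<Rightarrow> gelem" where
  "gP n j = (0\<^sub>m (n + 1) (n + 1), unit_vec (n + 1) (j - 1))"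

lemma bracket_gP:
  assumes "X \<in> carrier_mat (n + 1) (n + 1)" and "1 \<le> j" and "j \<le> n + 1"
  shows "g_bracket (X, 0\<^sub>v (n + 1)) (gP n j)
       = (0\<^sub>m (n + 1) (n + 1), X *\<^sub>v unit_vec (n + 1) (j - 1))"
  using assms by (auto simp: g_bracket_def gP_def intro!: eq_vecI)

text \<open>The weight $\sum_{i=1}^n \mu_i \omega_i$ is represented by its coordinate function, extended by
  0 outside $\{1, \dots, n\}$ so that equality of weights is equality of functions.\<close>

definition weights :: "nat \<Rightarrow> (nat \<Rightarrow> complex) set" where
  "weights n = {\<mu>. \<forall>i. i \<notin> {1..n} \<longrightarrow> \<mu> i = 0}"

definition mu_coeff :: "(nat \<Rightarrow> complex) \<Rightarrow> nat \<Rightarrow> nat \<Rightarrow> complex" where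
  "mu_coeff \<mu> k s = - (\<Sum>i=k..s. (\<mu> i + 1))"

definition P_mu :: "nat \<Rightarrow> (nat \<Rightarrow> complex) \<Rightarrow> nat \<Rightarrow> nat \<Rightarrow> gelem" where
  "P_mu n \<mu> s i = g_scale (\<Prod>k=1..<i. mu_coeff \<mu> k (s - 1)) (gP n i)"

definition F_mu :: "nat \<Rightarrow> (nat \<Rightarrow> complex) \<Rightarrow> nat \<Rightarrow> nat \<Rightarrow> nat \<Rightarrow> gelem" where
  "F_mu n \<mu> s i j = g_scale (\<Prod>k=i+1..j. mu_coeff \<mu> k s) (gF n i j)"

text \<open>The module is the whole type \<open>'v\<close>; only the values of \<open>act\<close> on \<^term>\<open>g_carrier n\<close>
  are relevant.\<close>

locale g_module = vector_space scale
  for scale :: "complex \<Rightarrow> 'v::ab_group_add \<Rightarrow> 'v" (infixr \<open>\<star>\<close> 75) +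
  fixes n :: nat and act :: "gelem \<Rightarrow> 'v \<Rightarrow> 'v"
  assumes fin_dim: "\<exists>B. finite B \<and> span B = UNIV"
    and act_linear: "x \<in> g_carrier n \<Longrightarrow> Vector_Spaces.linear scale scale (act x)"
    and act_add: "x \<in> g_carrier n \<Longrightarrow> y \<in> g_carrier n \<Longrightarrow> act (g_add x y) v = act x v + act y v"
    and act_scale: "x \<in> g_carrier n \<Longrightarrow> act (g_scale c x) v = c \<star> act x v"
    and act_bracket: "x \<in> g_carrier n \<Longrightarrow> y \<in> g_carrier n \<Longrightarrow>
      act (g_bracket x y) v = act x (act y v) - act y (act x v)"
begin

text \<open>The image in $End(V)$ of the enveloping algebra of the Lie subalgebra \<open>S\<close>: elements of
  enveloping algebras are identified with the operators by which they act on the module.\<close>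

inductive_set env_ops :: "gelem set \<Rightarrow> ('v \<Rightarrow> 'v) set" for S :: "gelem set" where
  env_one: "(\<lambda>v. v) \<in> env_ops S"
| env_gen: "x \<in> S \<Longrightarrow> act x \<in> env_ops S"
| env_scale: "f \<in> env_ops S \<Longrightarrow> (\<lambda>v. c \<star> f v) \<in> env_ops S"
| env_add: "f \<in> env_ops S \<Longrightarrow> h \<in> env_ops S \<Longrightarrow> (\<lambda>v. f v + h v) \<in> env_ops S"
| env_mult: "f \<in> env_ops S \<Longrightarrow> h \<in> env_ops S \<Longrightarrow> (\<lambda>v. f (h v)) \<in> env_ops S"

definition cyclic_gen :: "'v \<Rightarrow> bool" where
  "cyclic_gen v \<longleftrightarrow> {f v | f. f \<in> env_ops (g_carrier n)} = UNIV"

definition hwv :: "(nat \<Rightarrow> complex) \<Rightarrow> 'v \<Rightarrow> bool" where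
  "hwv \<mu> v \<longleftrightarrow> \<mu> \<in> weights n \<and> v \<noteq> 0
     \<and> (\<forall>i\<in>{1..n}. act (gH n i) v = \<mu> i \<star> v)
     \<and> (\<forall>p q. 1 \<le> p \<and> p \<le> q \<and> q \<le> n \<longrightarrow> act (gE n p q) v = 0)"

definition weight_of :: "'v \<Rightarrow> nat \<Rightarrow> complex" where
  "weight_of v = (THE \<mu>. hwv \<mu> v)"

lemma weight_of_eq:
  assumes "hwv \<mu> v"
  shows "weight_of v = \<mu>"
  unfolding weight_of_def
proof (rule the_equality)
  fix \<nu> assume "hwv \<nu> v"
  then have "\<nu> i = \<mu> i" for i
    using assms by (cases "i \<in> {1..n}") (auto simp: hwv_def weights_def)
  then show "\<nu> = \<mu>" by blast
qed (rule assms)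

text \<open>\<open>Q_op \<mu> s k\<close> is meant for $1 \le k \le s + 1$.\<close>

function Q_op :: "(nat \<Rightarrow> complex) \<Rightarrow> nat \<Rightarrow> nat \<Rightarrow> 'v \<Rightarrow> 'v" where
  "Q_op \<mu> s k = (if k > s then (\<lambda>v. v)
                  else (\<lambda>v. \<Sum>l=k..s. Q_op \<mu> s (l + 1) (act (F_mu n \<mu> s k l) v)))"
  by pat_completeness auto
termination
  by (relation "measure (\<lambda>(\<mu>, s, k). s + 1 - k)") auto

declare Q_op.simps [simp del]

lemma env_ops_sum:
  assumes "finite A" and "\<And>l. l \<in> A \<Longrightarrow> f l \<in> env_ops S"
  shows "(\<lambda>v. \<Sum>l\<in>A. f l v) \<in> env_ops S"
  using assms
proof (induction A rule: finite_induct)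
  case empty
  show ?case using env_scale[OF env_one, where c = 0] by simp
next
  case (insert a A)
  then show ?case using env_add[of "f a" S "\<lambda>v. \<Sum>l\<in>A. f l v"] by simp
qed

text \<open>\<open>Q_op \<mu> s k\<close> is indeed the action of an element of the enveloping algebra of $sl(n+1)$.\<close>

lemma Q_op_in_env_ops:
  assumes "1 \<le> k" and "s \<le> n"
  shows "Q_op \<mu> s k \<in> env_ops (sl_carrier n)"
  using assms
proof (induction \<mu> s k rule: Q_op.induct)
  case (1 \<mu> s k)
  show ?case
  proof (cases "k > s")
    case True
    then show ?thesis by (subst Q_op.simps) (simp add: env_one)
  next
    case False
    have "(\<lambda>v. Q_op \<mu> s (l + 1) (act (F_mu n \<mu> s k l) v)) \<in> env_ops (sl_carrier n)"
      if "l \<in> {k..s}" for l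
    proof (rule env_mult[where f = "Q_op \<mu> s (l + 1)" and h = "act (F_mu n \<mu> s k l)"])
      show "Q_op \<mu> s (l + 1) \<in> env_ops (sl_carrier n)"
        using 1 False that by simp
      have "F_mu n \<mu> s k l \<in> sl_carrier n"
        using 1 that
        by (auto simp: sl_carrier_def g_carrier_def F_mu_def g_scale_def gF_def mat_unit_def
              intro!: sum.neutral)
      then show "act (F_mu n \<mu> s k l) \<in> env_ops (sl_carrier n)" by (rule env_gen)
    qed
    then have "(\<lambda>v. \<Sum>l\<in>{k..s}. Q_op \<mu> s (l + 1) (act (F_mu n \<mu> s k l) v))
        \<in> env_ops (sl_carrier n)"
      by (intro env_ops_sum) auto
    then show ?thesis using False by (subst Q_op.simps) simp
  qed
qed

definition phi_at :: "(nat \<Rightarrow> complex) \<Rightarrow> nat \<Rightarrow> 'v \<Rightarrow> 'v" where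
  "phi_at \<mu> i v = act (P_mu n \<mu> i i) v
     + (\<Sum>k=1..<i. Q_op \<mu> (i - 1) k (act (P_mu n \<mu> i k) v))"

definition phi :: "nat \<Rightarrow> 'v \<Rightarrow> 'v" where
  "phi i v = (if v = 0 then 0 else phi_at (weight_of v) i v)"

text \<open>\<open>phi_word k [i\<^sub>1, \<dots>, i\<^sub>m]\<close> applies $\varphi_k^{i_1}$ first, then
  $\varphi_{k+1}^{i_2}$, and so on.\<close>

primrec phi_word :: "nat \<Rightarrow> nat list \<Rightarrow> 'v \<Rightarrow> 'v" where
  "phi_word k [] v = v"
| "phi_word k (i # is) v = phi_word (k + 1) is ((phi k ^^ i) v)"

text \<open>\<open>J_num v [i\<^sub>1, \<dots>, i\<^sub>m]\<close> is the number $J_{m+1}(i_1, \dots, i_m)$ computed from the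
  generator \<open>v\<close>, and \<open>J_index v\<close> is the set of all tuples at which these numbers are defined.\<close>

definition J_num :: "'v \<Rightarrow> nat list \<Rightarrow> nat" where
  "J_num v is = (LEAST J. J > 0 \<and> (phi (length is + 1) ^^ J) (phi_word 1 is v) = 0)"

definition J_index :: "'v \<Rightarrow> nat list set" where
  "J_index v = {is. length is \<le> n \<and> (\<forall>h<length is. is ! h < J_num v (take h is))}"

definition J_set :: "(nat \<Rightarrow> complex) \<Rightarrow> 'v \<Rightarrow> (nat \<Rightarrow> complex) \<times> (nat list \<Rightarrow> nat option)" where
  "J_set \<mu> v = (\<mu>, \<lambda>is. if is \<in> J_index v then Some (J_num v is) else None)"

end

definition g_module_equiv ::
  "nat \<Rightarrow> (complex \<Rightarrow> 'v::ab_group_add \<Rightarrow> 'v) \<Rightarrow> (gelem \<Rightarrow> 'v \<Rightarrow> 'v) \<Rightarrow>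
   (complex \<Rightarrow> 'w::ab_group_add \<Rightarrow> 'w) \<Rightarrow> (gelem \<Rightarrow> 'w \<Rightarrow> 'w) \<Rightarrow> bool" where
  "g_module_equiv n scaleV actV scaleW actW \<longleftrightarrow>
     (\<exists>T. Vector_Spaces.linear scaleV scaleW T \<and> bij T
        \<and> (\<forall>x\<in>g_carrier n. \<forall>v. T (actV x v) = actW x (T v)))"

end

theory Submission
  imports Defs
begin

text \<open>An isomorphism of modules commutes with every operation that enters the invariant, so the content
of the theorem is that $\mathcal{J}(V)$ does not depend on the generating highest weight vector:
if \<open>v\<close> and \<open>w\<close> are two such generators of the same module, then their weights agree
(\<open>generators_same_weight\<close>) and a word in the $\varphi_i$ kills \<open>v\<close> exactly if it kills
\<open>w\<close> (\<open>fold_phi_vanishing\<close>). The numbers $J_k$ only record which words vanish.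

In general the generator is not unique up to scalars: the sum of all weights of $\mathfrak{p}$ is zero,
so for instance $v + \varphi_{n+1} \cdots \varphi_1 v$ has the weight of $v$ too. Two facts make up for this.

First, the $\varphi_i$ commute on highest weight vectors (\<open>phi_commute\<close>). Modulo
$\mathfrak{n}^- V$ both $\varphi_i \varphi_j u$ and $\varphi_j \varphi_i u$ are multiples of
$P_j P_i u$, and the two multiples turn out to be the same product of weight differences. Hence the
difference is a singular vector in $\mathfrak{n}^- V$, and such a vector is zero
(\<open>singular_nminus_zero\<close>). The last step takes the place of complete reducibility: on a weight space
strictly above a dominant weight $m$ the Casimir operator of $\mathfrak{sl}(n+1)$ has no eigenvalue
equal to its value at $m$, so on $\mathfrak{n}^- V$ in weight $m$ it cannot take that value either.

Second, every singular vector is a linear combination of words in the $\varphi_i$ applied to the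
generator (\<open>singular_in_span_phi_orbit\<close>). Indeed the subspace spanned by these words together with
everything that the lowering operators make of them is a submodule: $P_s b$ can be solved for in the
formula for $\varphi_s b$, because the leading coefficient is a product of weight differences that
do not vanish for a dominant weight.

So if $w$ is a singular vector of the weight of $v$ and a word kills $v$, then it kills every word
applied to $v$, hence $w$. If the weights of $v$ and $w$ were different, then $w$ would lie in
$\mathfrak{p}V$; this is a submodule, and a proper one because $\mathfrak{p}$ acts nilpotently
(\<open>p_image_proper\<close>), so $w$ would not generate.\<close>

section \<open>Eigenvectors of a linear operator\<close>

locale operator_space = vector_space scale
  for scale :: "'a::field \<Rightarrow> 'b::ab_group_add \<Rightarrow> 'b" (infixr \<open>\<star>\<close> 75)
begin

text \<open>The vectors killed by some product of factors $T - e$ with $e \neq r$; in a finite dimensional complex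
space, the sum of the generalized eigenspaces for the other eigenvalues. The inductive form gives the
closure properties without polynomials in $T$.\<close>

inductive away :: "('b \<Rightarrow> 'b) \<Rightarrow> 'a \<Rightarrow> 'b \<Rightarrow> bool" for T r where
  away_zero: "away T r 0"
| away_step: "away T r (T x - e \<star> x) \<Longrightarrow> e \<noteq> r \<Longrightarrow> away T r x"

lemma lin_simps:
  assumes "Vector_Spaces.linear scale scale T"
  shows "T (x + y) = T x + T y" "T (c \<star> x) = c \<star> T x" "T 0 = 0" "T (x - y) = T x - T y"
    "T (- x) = - T x" "T (sum f A) = (\<Sum>a\<in>A. T (f a))"
proof -
  interpret T: Vector_Spaces.linear scale scale T by fact
  show "T (x + y) = T x + T y" "T (c \<star> x) = c \<star> T x" "T 0 = 0" "T (x - y) = T x - T y"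
    "T (- x) = - T x" "T (sum f A) = (\<Sum>a\<in>A. T (f a))"
    by (simp_all add: T.add T.scale T.zero T.diff T.neg T.sum)
qed

lemma linI:
  assumes "\<And>x y. T (x + y) = T x + T y" "\<And>c x. T (c \<star> x) = c \<star> T x"
  shows "Vector_Spaces.linear scale scale T"
  using assms by unfold_locales auto

lemma away_commuting:
  fixes T S :: "'b \<Rightarrow> 'b"
  assumes "away T r x" "Vector_Spaces.linear scale scale S" "\<And>y. S (T y) = T (S y)"
  shows "away T r (S x)"
  using assms(1)
proof induction
  case away_zero
  show ?case by (simp add: lin_simps[OF assms(2)] away.away_zero)
next
  case (away_step x e)
  then show ?case
    by (intro away.away_step[of T r "S x" e]) (simp_all add: lin_simps[OF assms(2)] assms(3))
qed

lemma away_add: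
  assumes T: "Vector_Spaces.linear scale scale T" and "away T r x" "away T r y"
  shows "away T r (x + y)"
  using assms(2,3)
proof (induction arbitrary: y)
  case away_zero
  then show ?case by simp
next
  case (away_step x e)
  have "Vector_Spaces.linear scale scale (\<lambda>y. T y - e \<star> y)"
    by (rule linI) (simp_all add: lin_simps[OF T] algebra_simps)
  from away_commuting[OF away_step.prems this]
  have "away T r (T y - e \<star> y)" by (simp add: lin_simps[OF T])
  from away_step.IH[OF this] show ?case
    by (intro away.away_step[of T r "x + y" e]) (simp_all add: lin_simps[OF T] algebra_simps away_step.hyps)
qed

lemma subspace_away:
  assumes T: "Vector_Spaces.linear scale scale T"
  shows "subspace {x. away T r x}"
proof (rule subspaceI)
  fix c x assume "x \<in> {x. away T r x}"
  moreover have "Vector_Spaces.linear scale scale (scale c)"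
    by (rule linI) (simp_all add: algebra_simps)
  ultimately show "c \<star> x \<in> {x. away T r x}"
    using away_commuting[of T r x "scale c"] by (simp add: lin_simps[OF T])
qed (auto intro: away_zero away_add[OF T])

lemma away_eigenvector:
  assumes "Vector_Spaces.linear scale scale T" "away T r x" "T x = r \<star> x"
  shows "x = 0"
  using assms(2,3)
proof induction
  case (away_step x e)
  have "T x - e \<star> x = (r - e) \<star> x" by (simp add: away_step.prems scale_left_diff_distrib)
  moreover have "T ((r - e) \<star> x) = r \<star> ((r - e) \<star> x)"
    by (simp add: lin_simps[OF assms(1)] away_step.prems mult.commute)
  ultimately have "(r - e) \<star> x = 0" using away_step.IH by simp
  then show ?case using away_step.hyps by simp
qed simp

lemma away_other_eigenvector:
  assumes "T x = e \<star> x" "e \<noteq> r"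
  shows "away T r x"
  by (rule away_step[of T r x e]) (simp_all add: assms away_zero)

text \<open>Eigenvectors for other eigenvalues contribute only a part that is both \<open>away\<close> from $r$ and an
eigenvector for $r$, hence zero. This replaces projections onto eigenspaces.\<close>

lemma span_eigenvectors:
  assumes T: "Vector_Spaces.linear scale scale T" and B: "\<And>b. b \<in> B \<Longrightarrow> \<exists>e. T b = e \<star> b"
    and w: "w \<in> span B" "T w = r \<star> w"
  shows "w \<in> span {b \<in> B. T b = r \<star> b}"
proof -
  let ?C = "{b \<in> B. T b = r \<star> b}"
  have "?C \<union> (B - ?C) = B" by auto
  with w(1) have "w \<in> span (?C \<union> (B - ?C))" by simp
  from this[unfolded span_Un] obtain y z where yz: "y \<in> span ?C" "z \<in> span (B - ?C)" "w = y + z"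
    by blast
  have "span (B - ?C) \<subseteq> {x. away T r x}"
    using B by (intro span_minimal subspace_away[OF T]) (force intro: away_other_eigenvector)
  then have "away T r z" using yz by auto
  moreover have "subspace {x. T x = r \<star> x}"
    by (intro subspaceI) (simp_all add: lin_simps[OF T] algebra_simps)
  then have "span ?C \<subseteq> {x. T x = r \<star> x}" by (intro span_minimal) auto
  then have "T z = r \<star> z" using yz w(2) by (auto simp: lin_simps[OF T] algebra_simps)
  ultimately have "z = 0" using away_eigenvector[OF T] by blast
  then show ?thesis using yz by simp
qed

text \<open>Eigenvectors for distinct eigenvalues are independent, and an independent subset of a finitely
spanned space is finite.\<close>

lemma finite_eigenvalues:
  assumes T: "Vector_Spaces.linear scale scale T" and S: "finite S" "span S = UNIV"
  shows "finite {r. \<exists>x. x \<noteq> 0 \<and> T x = r \<star> x}"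
proof -
  let ?R = "{r. \<exists>x. x \<noteq> 0 \<and> T x = r \<star> x}"
  define f where "f r = (SOME x. x \<noteq> 0 \<and> T x = r \<star> x)" for r
  have f: "f r \<noteq> 0" "T (f r) = r \<star> f r" if "r \<in> ?R" for r
  proof -
    from that have "\<exists>x. x \<noteq> 0 \<and> T x = r \<star> x" by simp
    from someI_ex[OF this] show "f r \<noteq> 0" "T (f r) = r \<star> f r" by (auto simp: f_def)
  qed
  have inj: "inj_on f ?R"
  proof (rule inj_onI)
    fix r s assume rs: "r \<in> ?R" "s \<in> ?R" "f r = f s"
    then have "r \<star> f r = s \<star> f r" using trans[OF sym[OF f(2)[OF rs(1)]] f(2)[OF rs(2), folded rs(3)]] by blast
    then show "r = s" using f(1)[OF rs(1)] by (simp only: scale_cancel_right) blast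
  qed
  have "independent (f ` ?R)"
    unfolding dependent_def
  proof (intro notI, elim bexE)
    fix x assume x: "x \<in> f ` ?R" "x \<in> span (f ` ?R - {x})"
    then obtain r where r: "r \<in> ?R" "x = f r" by auto
    have "span (f ` ?R - {x}) \<subseteq> {x. away T r x}"
    proof (intro span_minimal subspace_away[OF T] subsetI)
      fix y assume "y \<in> f ` ?R - {x}"
      then obtain s where "s \<in> ?R" "y = f s" "s \<noteq> r" using r by auto
      then show "y \<in> {x. away T r x}" using f(2)[of s] by (auto intro: away_other_eigenvector)
    qed
    then have "x = 0" using x(2) r f(2)[of r] away_eigenvector[OF T] by blast
    then show False using f(1)[OF r(1)] r(2) by simp
  qed
  then have "finite (f ` ?R)"
    using independent_span_bound[OF S(1)] S(2) by blast
  then show ?thesis using inj by (rule finite_imageD)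
qed

end

section \<open>The relations of $\mathfrak{gl}(n+1)$\<close>

sublocale g_module \<subseteq> operator_space scale ..

text \<open>The traceless part of the matrix unit $A_{i,j}$. These elements satisfy the relations of
$\mathfrak{gl}(n+1)$ because scalar matrices are central, so a module over $\mathfrak{sl}(n+1)$ can be
treated as one over $\mathfrak{gl}(n+1)$ with the diagonal units acting separately. The price is the
shift by $1/(n+1)$ in the commutators with $P_k$.\<close>

definition gl_elem :: "nat \<Rightarrow> nat \<Rightarrow> nat \<Rightarrow> gelem" where
  "gl_elem n i j = (mat (n + 1) (n + 1) (\<lambda>(a, b). (if a + 1 = i \<and> b + 1 = j then 1 else 0)
      - (if i = j \<and> a = b then 1 / of_nat (n + 1) else 0)), 0\<^sub>v (n + 1))"

lemma sum_delta_both: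
  fixes N :: nat
  shows "(\<Sum>c\<in>{0..<N}. (if P \<and> c + 1 = j then x else 0) * (f c :: complex))
     = (if P \<and> 1 \<le> j \<and> j \<le> N then x * f (j - 1) else 0)"
proof (cases "P \<and> 1 \<le> j \<and> j \<le> N")
  case True
  then have "(\<Sum>c\<in>{0..<N}. (if P \<and> c + 1 = j then x else 0) * f c)
      = (\<Sum>c\<in>{0..<N}. if c = j - 1 then x * f c else 0)"
    by (intro sum.cong) auto
  moreover have "j - 1 \<in> {0..<N}" using True by auto
  ultimately show ?thesis using True by (simp only: sum.delta' sum.delta finite_atLeastLessThan if_True simp_thms)
next
  case False
  then show ?thesis by (auto intro!: sum.neutral)
qed

lemma gl_elem_carrier:
  assumes "i \<in> {1..n + 1}" "j \<in> {1..n + 1}"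
  shows "gl_elem n i j \<in> g_carrier n"
proof -
  have "(\<Sum>a<n + 1. (if a + 1 = i \<and> a + 1 = j then 1 else (0::complex))) = (if i = j then 1 else 0)"
  proof -
    have "(\<Sum>a<n + 1. (if a + 1 = i \<and> a + 1 = j then 1 else (0::complex)))
        = (\<Sum>a<n + 1. if a = i - 1 then (if i = j then 1 else 0) else 0)"
      using assms by (intro sum.cong) auto
    then show ?thesis using assms by auto
  qed
  then show ?thesis
    using of_nat_neq_0[of n, where 'a = complex]
    by (auto simp: g_carrier_def gl_elem_def sum_subtractf simp del: sum.lessThan_Suc lessThan_Suc of_nat_Suc)
qed

lemma gP_carrier: "gP n k \<in> g_carrier n"
  by (simp add: g_carrier_def gP_def)

lemma gl_elem_mult:
  assumes "i \<in> {1..n + 1}" "j \<in> {1..n + 1}" "k \<in> {1..n + 1}" "l \<in> {1..n + 1}"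
    and ab: "a < n + 1" "b < n + 1"
  defines "t \<equiv> 1 / of_nat (n + 1)"
    and "u \<equiv> \<lambda>i j. if a + 1 = i \<and> b + 1 = j then 1 else (0::complex)"
  shows "(fst (gl_elem n i j) * fst (gl_elem n k l)) $$ (a, b)
      = (if j = k then u i l else 0) - (if k = l then t * u i j else 0)
        - (if i = j then t * u k l else 0) + (if i = j \<and> k = l \<and> a = b then t * t else 0)"
proof -
  let ?g = "\<lambda>c. (if c + 1 = k \<and> b + 1 = l then 1 else 0) - (if k = l \<and> c = b then t else 0)"
  have "(fst (gl_elem n i j) * fst (gl_elem n k l)) $$ (a, b)
      = (\<Sum>c\<in>{0..<n + 1}. ((if a + 1 = i \<and> c + 1 = j then 1 else 0) - (if i = j \<and> a = c then t else 0)) * ?g c)"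
    using ab unfolding t_def by (simp add: gl_elem_def scalar_prod_def del: sum.op_ivl_Suc of_nat_Suc)
  also have "\<dots> = (\<Sum>c\<in>{0..<n + 1}. (if a + 1 = i \<and> c + 1 = j then 1 else 0) * ?g c)
      - (\<Sum>c\<in>{0..<n + 1}. (if i = j \<and> c + 1 = a + 1 then t else 0) * ?g c)"
    unfolding sum_subtractf[symmetric] left_diff_distrib
    by (intro sum.cong refl arg_cong2[where f = "(-)"] arg_cong2[where f = "(*)"]) auto
  also have "\<dots> = (if a + 1 = i then ?g (j - 1) else 0) - (if i = j then t * ?g a else 0)"
    unfolding sum_delta_both using ab assms(1-4) by simp
  also have "(if a + 1 = i then ?g (j - 1) else 0)
      = (if j = k then u i l else 0) - (if k = l then t * u i j else 0)"
    using assms(1-4) by (cases j) (simp_all add: u_def)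
  also have "(if i = j then t * ?g a else 0)
      = (if i = j then t * u k l else 0) - (if i = j \<and> k = l \<and> a = b then t * t else 0)"
    by (simp add: u_def right_diff_distrib)
  finally show ?thesis by simp
qed

lemma gl_elem_bracket:
  assumes "i \<in> {1..n + 1}" "j \<in> {1..n + 1}" "k \<in> {1..n + 1}" "l \<in> {1..n + 1}"
  shows "g_bracket (gl_elem n i j) (gl_elem n k l)
    = g_add (g_scale (if j = k then 1 else 0) (gl_elem n i l))
            (g_scale (if i = l then -1 else 0) (gl_elem n k j))"
proof -
  have "fst (gl_elem n i j) * fst (gl_elem n k l) - fst (gl_elem n k l) * fst (gl_elem n i j)
     = (if j = k then 1 else 0) \<cdot>\<^sub>m fst (gl_elem n i l) + (if i = l then -1 else 0) \<cdot>\<^sub>m fst (gl_elem n k j)"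
    (is "?L = ?R")
  proof (rule eq_matI)
    fix a b assume "a < dim_row ?R" "b < dim_col ?R"
    then have ab: "a < n + 1" "b < n + 1" by (simp_all add: gl_elem_def)
    define t where "t = (1::complex) / of_nat (n + 1)"
    define u where "u i j = (if a + 1 = i \<and> b + 1 = j then 1 else (0::complex))" for i j
    have entry: "fst (gl_elem n i j) $$ (a, b) = u i j - (if i = j \<and> a = b then t else 0)" for i j
      using ab by (simp add: gl_elem_def u_def t_def)
    have "?L $$ (a, b) = (fst (gl_elem n i j) * fst (gl_elem n k l)) $$ (a, b)
        - (fst (gl_elem n k l) * fst (gl_elem n i j)) $$ (a, b)"
      using ab by (subst index_minus_mat) (simp_all add: gl_elem_def)
    also have "\<dots> = (if j = k then u i l else 0) - (if i = l then u k j else 0)"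
      unfolding gl_elem_mult[OF assms ab] gl_elem_mult[OF assms(3,4,1,2) ab] u_def[symmetric] t_def[symmetric]
      by simp
    also have "\<dots> = (if j = k then 1 else 0) * fst (gl_elem n i l) $$ (a, b)
        + (if i = l then -1 else 0) * fst (gl_elem n k j) $$ (a, b)"
      unfolding entry by simp
    also have "\<dots> = ?R $$ (a, b)"
      using ab by (subst index_add_mat) (simp_all add: gl_elem_def)
    finally show "?L $$ (a, b) = ?R $$ (a, b)" .
  qed (simp_all add: gl_elem_def)
  moreover have "fst (gl_elem n i j) *\<^sub>v snd (gl_elem n k l) - fst (gl_elem n k l) *\<^sub>v snd (gl_elem n i j)
    = (if j = k then 1 else 0) \<cdot>\<^sub>v snd (gl_elem n i l) + (if i = l then -1 else 0) \<cdot>\<^sub>v snd (gl_elem n k j)"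
    by (auto simp: gl_elem_def intro!: eq_vecI)
  ultimately show ?thesis by (simp add: g_bracket_def g_add_def g_scale_def)
qed

lemma gl_elem_bracket_gP:
  assumes "i \<in> {1..n + 1}" "j \<in> {1..n + 1}" "k \<in> {1..n + 1}"
  shows "g_bracket (gl_elem n i j) (gP n k)
    = g_add (g_scale (if j = k then 1 else 0) (gP n i))
            (g_scale (if i = j then - (1 / of_nat (n + 1)) else 0) (gP n k))"
proof -
  have "fst (gl_elem n i j) *\<^sub>v unit_vec (n + 1) (k - 1) = col (fst (gl_elem n i j)) (k - 1)"
    using assms by (intro eq_vecI) (auto simp: gl_elem_def scalar_prod_right_unit)
  then show ?thesis using assms
    by (auto simp: g_bracket_def g_add_def g_scale_def gP_def gl_elem_def unit_vec_def intro!: eq_vecI eq_matI)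
qed

lemma gP_bracket: "g_bracket (gP n j) (gP n k) = g_scale 0 (gP n k)"
  by (auto simp: g_bracket_def g_scale_def gP_def intro!: eq_vecI)

context g_module
begin

definition gl :: "nat \<Rightarrow> nat \<Rightarrow> 'v \<Rightarrow> 'v" where
  "gl i j = act (gl_elem n i j)"

definition pp :: "nat \<Rightarrow> 'v \<Rightarrow> 'v" where
  "pp k = act (gP n k)"

abbreviation idx :: "nat set" where "idx \<equiv> {1..n + 1}"

lemma lin_gl: "i \<in> idx \<Longrightarrow> j \<in> idx \<Longrightarrow> Vector_Spaces.linear scale scale (gl i j)"
  unfolding gl_def by (rule act_linear[OF gl_elem_carrier])

lemma lin_pp: "Vector_Spaces.linear scale scale (pp k)"
  unfolding pp_def by (rule act_linear[OF gP_carrier])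

lemmas gl_simps = lin_simps[OF lin_gl]
lemmas pp_simps = lin_simps[OF lin_pp]

lemma g_carrier_scale: "x \<in> g_carrier n \<Longrightarrow> g_scale c x \<in> g_carrier n"
  by (auto simp: g_carrier_def g_scale_def sum_distrib_left[symmetric] simp del: sum.lessThan_Suc)

lemma g_carrier_add: "x \<in> g_carrier n \<Longrightarrow> y \<in> g_carrier n \<Longrightarrow> g_add x y \<in> g_carrier n"
  by (cases x, cases y) (auto simp: g_carrier_def g_add_def sum.distrib simp del: sum.lessThan_Suc)

lemma gl_gl:
  assumes "i \<in> idx" "j \<in> idx" "k \<in> idx" "l \<in> idx"
  shows "gl i j (gl k l x) = gl k l (gl i j x) + (if j = k then gl i l x else 0)
      - (if i = l then gl k j x else 0)"
proof -
  have "gl i j (gl k l x) - gl k l (gl i j x) = act (g_bracket (gl_elem n i j) (gl_elem n k l)) x"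
    unfolding gl_def by (rule act_bracket[symmetric]) (simp_all only: gl_elem_carrier assms)
  also have "\<dots> = (if j = k then 1 else 0) \<star> gl i l x + (if i = l then -1 else 0) \<star> gl k j x"
    unfolding gl_elem_bracket[OF assms] gl_def
    by (simp only: act_add act_scale g_carrier_scale gl_elem_carrier assms)
  finally show ?thesis by (auto simp: algebra_simps split: if_splits)
qed

lemma gl_pp:
  assumes "i \<in> idx" "j \<in> idx" "k \<in> idx"
  shows "gl i j (pp k x) = pp k (gl i j x) + (if j = k then pp i x else 0)
      - (if i = j then (1 / of_nat (n + 1)) \<star> pp k x else 0)"
proof -
  have "gl i j (pp k x) - pp k (gl i j x) = act (g_bracket (gl_elem n i j) (gP n k)) x"
    unfolding gl_def pp_def by (rule act_bracket[symmetric]) (simp_all only: gl_elem_carrier gP_carrier assms)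
  also have "\<dots> = (if j = k then 1 else 0) \<star> pp i x
      + (if i = j then - (1 / of_nat (n + 1)) else 0) \<star> pp k x"
    unfolding gl_elem_bracket_gP[OF assms] pp_def
    by (simp only: act_add act_scale g_carrier_scale gP_carrier)
  finally show ?thesis by (auto simp: algebra_simps split: if_splits)
qed

lemma pp_pp: "pp j (pp k x) = pp k (pp j x)"
proof -
  have "pp j (pp k x) - pp k (pp j x) = act (g_bracket (gP n j) (gP n k)) x"
    unfolding pp_def by (rule act_bracket[symmetric]) (simp_all only: gP_carrier)
  also have "\<dots> = 0" unfolding gP_bracket by (simp only: act_scale gP_carrier scale_zero_left)
  finally show ?thesis by simp
qed

lemma act_lincomb:
  assumes "finite S" "\<And>s. s \<in> S \<Longrightarrow> f s \<in> g_carrier n"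
  shows "(mat (n + 1) (n + 1) (\<lambda>ab. \<Sum>s\<in>S. c s * fst (f s) $$ ab),
          vec (n + 1) (\<lambda>a. \<Sum>s\<in>S. c s * snd (f s) $ a)) \<in> g_carrier n
     \<and> act (mat (n + 1) (n + 1) (\<lambda>ab. \<Sum>s\<in>S. c s * fst (f s) $$ ab),
          vec (n + 1) (\<lambda>a. \<Sum>s\<in>S. c s * snd (f s) $ a)) x = (\<Sum>s\<in>S. c s \<star> act (f s) x)"
  (is "?e S \<in> _ \<and> _ = _")
  using assms
proof (induction S rule: finite_induct)
  case empty
  have "?e {} = g_scale 0 (gP n 1)"
    by (auto simp: g_scale_def gP_def intro!: eq_matI eq_vecI)
  then show ?case
    using g_carrier_scale[OF gP_carrier] by (simp only: act_scale gP_carrier sum.empty scale_zero_left)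
next
  case (insert s S)
  have fs: "f s \<in> g_carrier n" using insert.prems by simp
  have IH: "?e S \<in> g_carrier n" "act (?e S) x = (\<Sum>s\<in>S. c s \<star> act (f s) x)"
    using insert by auto
  have eq: "?e (insert s S) = g_add (g_scale (c s) (f s)) (?e S)"
    using fs insert.hyps
    by (cases "f s") (auto simp: g_add_def g_scale_def g_carrier_def intro!: eq_matI eq_vecI)
  have "g_add (g_scale (c s) (f s)) (?e S) \<in> g_carrier n"
    using g_carrier_scale[OF fs, of "c s"] IH(1)
    by (cases "f s") (auto simp: g_add_def g_scale_def g_carrier_def sum.distrib simp del: sum.lessThan_Suc)
  then show ?case unfolding eq
    using insert.hyps IH by (simp add: act_add act_scale g_carrier_scale fs)
qed

text \<open>Once the trace of $X$ vanishes, the corrections in \<open>gl_elem\<close> cancel, so the coefficients of $X$ with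
respect to the matrix units can be used for the traceless parts.\<close>

lemma act_expand:
  assumes "X \<in> carrier_mat (n + 1) (n + 1)" "(\<Sum>i<n + 1. X $$ (i, i)) = 0" "p \<in> carrier_vec (n + 1)"
  shows "act (X, p) x = (\<Sum>i\<in>idx. \<Sum>j\<in>idx. X $$ (i - 1, j - 1) \<star> gl i j x)
      + (\<Sum>k\<in>idx. p $ (k - 1) \<star> pp k x)"
proof -
  let ?S = "idx \<times> idx"
  let ?c = "\<lambda>(i, j). X $$ (i - 1, j - 1)" and ?f = "\<lambda>(i, j). gl_elem n i j"
  let ?d = "\<lambda>k. p $ (k - 1)" and ?h = "gP n"
  let ?A = "(mat (n + 1) (n + 1) (\<lambda>ab. \<Sum>s\<in>?S. ?c s * fst (?f s) $$ ab),
          vec (n + 1) (\<lambda>a. \<Sum>s\<in>?S. ?c s * snd (?f s) $ a))"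
  let ?B = "(mat (n + 1) (n + 1) (\<lambda>ab. \<Sum>s\<in>idx. ?d s * fst (?h s) $$ ab),
          vec (n + 1) (\<lambda>a. \<Sum>s\<in>idx. ?d s * snd (?h s) $ a))"
  have A: "?A \<in> g_carrier n \<and> act ?A x = (\<Sum>s\<in>?S. ?c s \<star> act (?f s) x)"
    by (rule act_lincomb) (auto intro!: gl_elem_carrier)
  have B: "?B \<in> g_carrier n \<and> act ?B x = (\<Sum>s\<in>idx. ?d s \<star> act (?h s) x)"
    by (rule act_lincomb) (auto intro!: gP_carrier)
  have X: "X = mat (n + 1) (n + 1) (\<lambda>ab. \<Sum>s\<in>?S. ?c s * fst (?f s) $$ ab)"
  proof (rule eq_matI; simp only: dim_row_mat dim_col_mat)
    fix a b assume ab: "a < n + 1" "b < n + 1"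
    have entry: "fst (gl_elem n i j) $$ (a, b) = (if a + 1 = i \<and> b + 1 = j then 1 else 0)
          - (if i = j \<and> a = b then 1 / of_nat (n + 1) else 0)" for i j
      using ab by (simp add: gl_elem_def)
    have "(\<Sum>s\<in>?S. ?c s * fst (?f s) $$ (a, b))
      = (\<Sum>i\<in>idx. \<Sum>j\<in>idx. X $$ (i - 1, j - 1) * fst (gl_elem n i j) $$ (a, b))"
      by (simp only: sum.cartesian_product case_prod_unfold)
    also have "\<dots> = (\<Sum>i\<in>idx. \<Sum>j\<in>idx. X $$ (i - 1, j - 1) * ((if a + 1 = i \<and> b + 1 = j then 1 else 0)
          - (if i = j \<and> a = b then 1 / of_nat (n + 1) else 0)))"
      by (simp only: entry)
    also have "\<dots> = (\<Sum>i\<in>idx. \<Sum>j\<in>idx. if j = b + 1 then if i = a + 1 then X $$ (a, b) else 0 else 0)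
          - (\<Sum>i\<in>idx. \<Sum>j\<in>idx. if j = i then if a = b then X $$ (i - 1, i - 1) / of_nat (n + 1) else 0 else 0)"
      unfolding sum_subtractf[symmetric] by (intro sum.cong refl) (auto simp: algebra_simps)
    also have "(\<Sum>i\<in>idx. \<Sum>j\<in>idx. if j = i then if a = b then X $$ (i - 1, i - 1) / of_nat (n + 1) else 0 else 0)
       = (\<Sum>i\<in>idx. if a = b then X $$ (i - 1, i - 1) / of_nat (n + 1) else 0)"
      by (intro sum.cong refl) (simp only: sum.delta finite_atLeastAtMost if_True)
    also have "\<dots> = (if a = b then (\<Sum>i\<in>idx. X $$ (i - 1, i - 1)) / of_nat (n + 1) else 0)"
      by (cases "a = b") (simp_all only: sum_divide_distrib if_True if_False sum.neutral_const simp_thms)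
    also have "(\<Sum>i\<in>idx. X $$ (i - 1, i - 1)) = (\<Sum>i<n + 1. X $$ (i, i))"
      by (rule sum.reindex_bij_witness[of _ Suc "\<lambda>i. i - 1"]) auto
    also have "\<dots> = 0" by fact
    finally show "X $$ (a, b) = mat (n + 1) (n + 1) (\<lambda>ab. \<Sum>s\<in>?S. ?c s * fst (?f s) $$ ab) $$ (a, b)"
      using ab by simp
  qed (use assms in auto)
  have p: "p = vec (n + 1) (\<lambda>a. \<Sum>s\<in>idx. ?d s * snd (?h s) $ a)"
  proof (rule eq_vecI; simp only: dim_vec)
    fix a assume a: "a < n + 1"
    have "(\<Sum>s\<in>idx. ?d s * snd (?h s) $ a) = (\<Sum>s\<in>idx. if s = a + 1 then p $ a else 0)"
      using a by (intro sum.cong refl) (auto simp: gP_def unit_vec_def)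
    then show "p $ a = vec (n + 1) (\<lambda>a. \<Sum>s\<in>idx. ?d s * snd (?h s) $ a) $ a"
      using a by simp
  qed (use assms in auto)
  have "(X, p) = g_add ?A ?B"
  proof -
    have "vec (n + 1) (\<lambda>a. \<Sum>s\<in>?S. ?c s * snd (?f s) $ a) = 0\<^sub>v (n + 1)"
      by (auto simp: gl_elem_def case_prod_unfold intro!: eq_vecI)
    moreover have "mat (n + 1) (n + 1) (\<lambda>ab. \<Sum>s\<in>idx. ?d s * fst (?h s) $$ ab) = 0\<^sub>m (n + 1) (n + 1)"
      by (auto simp: gP_def intro!: eq_matI)
    ultimately show ?thesis unfolding g_add_def fst_conv snd_conv X[symmetric] p[symmetric]
      using assms by simp
  qed
  then have "act (X, p) x = act ?A x + act ?B x" using A B by (simp only: act_add)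
  also have "\<dots> = (\<Sum>s\<in>?S. ?c s \<star> act (?f s) x) + (\<Sum>s\<in>idx. ?d s \<star> act (?h s) x)"
    using A B by simp
  finally show ?thesis
    by (simp only: gl_def pp_def sum.cartesian_product case_prod_unfold)
qed

section \<open>Singular vectors and the operators that raise them\<close>

text \<open>The zero vector counts as a weight vector and as a singular vector for every weight, so that for a
fixed weight they form subspaces.\<close>

definition weight_vec :: "(nat \<Rightarrow> complex) \<Rightarrow> 'v \<Rightarrow> bool" where
  "weight_vec m x \<longleftrightarrow> (\<forall>i\<in>idx. gl i i x = m i \<star> x)"

definition singular :: "(nat \<Rightarrow> complex) \<Rightarrow> 'v \<Rightarrow> bool" where
  "singular m x \<longleftrightarrow> weight_vec m x \<and> (\<forall>i\<in>idx. \<forall>j\<in>idx. i < j \<longrightarrow> gl i j x = 0)"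

text \<open>The last summand comes from acting through the traceless parts: it makes the coordinates of the
weight of $P_s$ sum to zero.\<close>

definition shift :: "(nat \<Rightarrow> complex) \<Rightarrow> nat \<Rightarrow> nat \<Rightarrow> complex" where
  "shift m s i = m i + (if i = s then 1 else 0) - 1 / of_nat (n + 1)"

text \<open>The factor $\mu_{k,s-1}$ for a weight $\mu$ with $\mathfrak{gl}$-coordinates $m$: the difference of the
entries $s$ and $k$ of $m + \rho$.\<close>

definition gap :: "(nat \<Rightarrow> complex) \<Rightarrow> nat \<Rightarrow> nat \<Rightarrow> complex" where
  "gap m s k = (m s - of_nat s) - (m k - of_nat k)"

text \<open>The vector $\varphi_s(u)$ built up along the first index: \<open>raise d s u\<close> with \<open>d = gap m s\<close> is
$\varphi_s(u)$, and the vectors \<open>raise d a u\<close> with $a < s$ and the same \<open>d\<close> are partial sums over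
chains that end at $a$ instead of $s$. They obey a recursion on $a$, which the original form of
$\varphi_s$, recursive from the other end through \<open>Q_op\<close>, does not.\<close>

function raise :: "(nat \<Rightarrow> complex) \<Rightarrow> nat \<Rightarrow> 'v \<Rightarrow> 'v" where
  "raise d a u = (\<Prod>k=1..<a. d k) \<star> pp a u
     + (\<Sum>b=1..<a. (\<Prod>k=b + 1..<a. d k) \<star> gl a b (raise d b u))"
  by pat_completeness auto
termination
  by (relation "measure (\<lambda>(d, a, u). a)") auto

declare raise.simps [simp del]

lemma weight_vecD: "weight_vec m x \<Longrightarrow> i \<in> idx \<Longrightarrow> gl i i x = m i \<star> x"
  by (simp add: weight_vec_def)

lemma subspace_weight_vec: "subspace {x. weight_vec m x}"
  by (rule subspaceI) (auto simp: weight_vec_def gl_simps scale_right_distrib mult.commute)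

lemma subspace_singular: "subspace {x. singular m x}"
proof -
  have "subspace {x. \<forall>i\<in>idx. \<forall>j\<in>idx. i < j \<longrightarrow> gl i j x = 0}"
    by (rule subspaceI) (auto simp: gl_simps)
  from subspace_inter[OF subspace_weight_vec this] show ?thesis
    by (simp add: singular_def Int_def)
qed

lemma singular_weight_vec: "singular m x \<Longrightarrow> weight_vec m x"
  by (simp add: singular_def)

lemma weight_vec_unique:
  assumes "weight_vec m x" "weight_vec m' x" "x \<noteq> 0" "i \<in> idx"
  shows "m i = m' i"
  using weight_vecD[OF assms(1,4)] weight_vecD[OF assms(2,4)] assms(3) by auto

lemma weight_vec_gl:
  assumes "weight_vec m x" "i \<in> idx" "j \<in> idx"
  shows "weight_vec (\<lambda>k. m k + (if k = i then 1 else 0) - (if k = j then 1 else 0)) (gl i j x)"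
  unfolding weight_vec_def
proof
  fix k assume k: "k \<in> idx"
  have "gl k k (gl i j x) = gl i j (m k \<star> x) + (if k = i then gl k j x else 0)
      - (if k = j then gl i k x else 0)"
    using gl_gl[OF k k assms(2,3), of x] weight_vecD[OF assms(1) k] by (auto split: if_splits)
  also have "\<dots> = (m k + (if k = i then 1 else 0) - (if k = j then 1 else 0)) \<star> gl i j x"
    using assms(2,3) by (simp add: gl_simps scale_left_distrib scale_left_diff_distrib)
  finally show "gl k k (gl i j x)
      = (m k + (if k = i then 1 else 0) - (if k = j then 1 else 0)) \<star> gl i j x" .
qed

lemma weight_vec_pp:
  assumes "weight_vec m x" "s \<in> idx"
  shows "weight_vec (shift m s) (pp s x)"
  unfolding weight_vec_def
proof
  fix k assume k: "k \<in> idx"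
  have "gl k k (pp s x) = pp s (m k \<star> x) + (if k = s then pp k x else 0)
      - (1 / of_nat (n + 1)) \<star> pp s x"
    using gl_pp[OF k k assms(2), of x] weight_vecD[OF assms(1) k] by simp
  also have "\<dots> = shift m s k \<star> pp s x"
    by (simp add: pp_simps shift_def scale_left_distrib scale_left_diff_distrib)
  finally show "gl k k (pp s x) = shift m s k \<star> pp s x" .
qed

lemma lin_raise:
  assumes "a \<in> idx"
  shows "Vector_Spaces.linear scale scale (raise d a)"
  using assms
proof (induction a rule: less_induct)
  case (less a)
  have IH: "raise d b (x + y) = raise d b x + raise d b y" "raise d b (c \<star> x) = c \<star> raise d b x"
    if "b \<in> {1..<a}" for b x y c
    using lin_simps[OF less.IH[of b]] that less.prems by auto
  show ?case
  proof (rule linI)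
    fix x y
    have "raise d a (x + y) = (\<Prod>k=1..<a. d k) \<star> pp a (x + y)
      + (\<Sum>b=1..<a. (\<Prod>k=b + 1..<a. d k) \<star> gl a b (raise d b x)
          + (\<Prod>k=b + 1..<a. d k) \<star> gl a b (raise d b y))"
      using less.prems by (subst raise.simps) (simp add: IH gl_simps scale_right_distrib)
    then show "raise d a (x + y) = raise d a x + raise d a y"
      by (simp add: pp_simps scale_right_distrib sum.distrib raise.simps[of d a x] raise.simps[of d a y])
  next
    fix c x
    have "raise d a (c \<star> x) = (\<Prod>k=1..<a. d k) \<star> pp a (c \<star> x)
      + (\<Sum>b=1..<a. c \<star> ((\<Prod>k=b + 1..<a. d k) \<star> gl a b (raise d b x)))"
      using less.prems by (subst raise.simps) (simp add: IH gl_simps mult.commute)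
    then show "raise d a (c \<star> x) = c \<star> raise d a x"
      by (simp add: pp_simps scale_right_distrib scale_sum_right raise.simps[of d a x] mult.commute)
  qed
qed

lemma weight_vec_raise:
  assumes "weight_vec m u" "a \<in> idx"
  shows "weight_vec (shift m a) (raise d a u)"
  using assms(2)
proof (induction a rule: less_induct)
  case (less a)
  have "weight_vec (shift m a) ((\<Prod>k=b + 1..<a. d k) \<star> gl a b (raise d b u))" if b: "b \<in> {1..<a}" for b
  proof -
    have "weight_vec (shift m b) (raise d b u)" using less b by auto
    from weight_vec_gl[OF this, of a b] have "weight_vec (shift m a) (gl a b (raise d b u))"
      using less.prems b by (simp add: weight_vec_def shift_def)
    then show ?thesis using subspace_scale[OF subspace_weight_vec] by simp
  qed
  then have "(\<Sum>b=1..<a. (\<Prod>k=b + 1..<a. d k) \<star> gl a b (raise d b u)) \<in> {x. weight_vec (shift m a) x}"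
    by (intro subspace_sum subspace_weight_vec) simp
  moreover have "(\<Prod>k=1..<a. d k) \<star> pp a u \<in> {x. weight_vec (shift m a) x}"
    using weight_vec_pp[OF assms(1) less.prems] by (intro subspace_scale subspace_weight_vec) simp
  ultimately show ?case
    using subspace_add[OF subspace_weight_vec] by (subst raise.simps) blast
qed

text \<open>The simple root operator $A_{p,p+1}$ takes the $(p+1)$-st partial sum to a multiple of the $p$-th and
kills the others. For $a > p + 1$ the two surviving terms cancel because
$\prod_{p<k<a} d_k = d_{p+1} \prod_{p+1<k<a} d_k$; for $a = p + 1$ the weight of \<open>raise d p u\<close> turns the
factor $d_p$ into $d_{p+1}$.\<close>

lemma raise_simple_root:
  assumes u: "singular m u" and s: "s \<in> idx" and a: "1 \<le> a" "a \<le> s" and p: "1 \<le> p" "p \<le> n"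
  defines "d \<equiv> gap m s"
  shows "gl p (p + 1) (raise d a u) = (if a = p + 1 then d a \<star> raise d p u else 0)"
  using a
proof (induction a rule: less_induct)
  case (less a)
  let ?D = "\<lambda>b. \<Prod>k=b + 1..<a. d k"
  let ?y = "\<lambda>b. raise d b u"
  have ai: "a \<in> idx" using less.prems s by auto
  have pi: "p \<in> idx" "p + 1 \<in> idx" using p by auto
  have eu: "gl p (p + 1) u = 0" using u pi by (auto simp: singular_def)
  have summand: "gl p (p + 1) (gl a b (?y b)) =
      (if b = p + 1 then d b \<star> gl a b (?y p) else 0) + (if a = p + 1 then gl p b (?y b) else 0)
      - (if b = p then gl a (p + 1) (?y p) else 0)" if b: "b \<in> {1..<a}" for b
  proof -
    have bi: "b \<in> idx" using b ai by auto
    have "gl p (p + 1) (?y b) = (if b = p + 1 then d b \<star> ?y p else 0)"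
      using less.IH[of b] b less.prems by auto
    then have "gl a b (gl p (p + 1) (?y b)) = (if b = p + 1 then d b \<star> gl a b (?y p) else 0)"
      by (simp only: if_distrib[where f = "gl a b"] lin_simps[OF lin_gl[OF ai bi]])
    moreover have "(if p + 1 = a then gl p b (?y b) else 0) = (if a = p + 1 then gl p b (?y b) else 0)"
      "(if p = b then gl a (p + 1) (?y b) else 0) = (if b = p then gl a (p + 1) (?y p) else 0)"
      by auto
    ultimately show ?thesis
      using gl_gl[OF pi ai bi, of "?y b"] by (simp only:)
  qed
  have "gl p (p + 1) (raise d a u) = (\<Prod>k=1..<a. d k) \<star> gl p (p + 1) (pp a u)
      + (\<Sum>b=1..<a. ?D b \<star> gl p (p + 1) (gl a b (?y b)))"
    by (subst raise.simps) (simp only: lin_simps[OF lin_gl[OF pi]])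
  also have "gl p (p + 1) (pp a u) = (if a = p + 1 then pp p u else 0)"
    using gl_pp[OF pi ai, of u] eu by (simp add: pp_simps)
  also have "(\<Sum>b=1..<a. ?D b \<star> gl p (p + 1) (gl a b (?y b)))
    = (\<Sum>b=1..<a. ?D b \<star> ((if b = p + 1 then d b \<star> gl a b (?y p) else 0)
         + (if a = p + 1 then gl p b (?y b) else 0) - (if b = p then gl a (p + 1) (?y p) else 0)))"
    by (intro sum.cong refl) (simp only: summand)
  finally have *: "gl p (p + 1) (raise d a u) = (\<Prod>k=1..<a. d k) \<star> (if a = p + 1 then pp p u else 0)
    + (\<Sum>b=1..<a. ?D b \<star> ((if b = p + 1 then d b \<star> gl a b (?y p) else 0)
         + (if a = p + 1 then gl p b (?y b) else 0) - (if b = p then gl a (p + 1) (?y p) else 0)))" .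
  consider "a \<le> p" | "a = p + 1" | "p + 1 < a" by linarith
  then show ?case
  proof cases
    case 1
    then have "(\<Sum>b=1..<a. ?D b \<star> ((if b = p + 1 then d b \<star> gl a b (?y p) else 0)
         + (if a = p + 1 then gl p b (?y b) else 0) - (if b = p then gl a (p + 1) (?y p) else 0))) = 0"
      by (intro sum.neutral) auto
    then show ?thesis unfolding * using 1 by simp
  next
    case 2
    have prod: "(\<Prod>k=b..<p + 1. d k) = d p * (\<Prod>k=b..<p. d k)" if "b \<le> p" for b
      using that by (simp add: prod.atLeastLessThan_Suc mult.commute)
    have wt: "weight_vec (shift m p) (?y p)"
      by (rule weight_vec_raise[OF singular_weight_vec[OF u] pi(1)])
    have "(\<Sum>b=1..<a. ?D b \<star> ((if b = p + 1 then d b \<star> gl a b (?y p) else 0)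
         + (if a = p + 1 then gl p b (?y b) else 0) - (if b = p then gl a (p + 1) (?y p) else 0)))
      = (\<Sum>b=1..<p. (d p * (\<Prod>k=b + 1..<p. d k)) \<star> gl p b (?y b))
        + (gl p p (?y p) - gl (p + 1) (p + 1) (?y p))"
    proof -
      have set: "{1..<a} = insert p {1..<p}" using 2 p by auto
      show ?thesis unfolding set using 2
        by (subst sum.insert) (auto intro!: sum.cong simp: prod[symmetric])
    qed
    also have "(\<Sum>b=1..<p. (d p * (\<Prod>k=b + 1..<p. d k)) \<star> gl p b (?y b))
      = d p \<star> (\<Sum>b=1..<p. (\<Prod>k=b + 1..<p. d k) \<star> gl p b (?y b))"
      by (simp add: scale_sum_right)
    finally have "gl p (p + 1) (raise d a u) = d p \<star> raise d p u + (gl p p (?y p) - gl (p + 1) (p + 1) (?y p))"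
      unfolding * raise.simps[of d p] using 2 prod[of 1] p by (simp add: scale_right_distrib)
    also have "\<dots> = (d p + (shift m p p - shift m p (p + 1))) \<star> ?y p"
      unfolding weight_vecD[OF wt pi(1)] weight_vecD[OF wt pi(2)] by (simp add: scale_left_distrib scale_left_diff_distrib)
    also have "d p + (shift m p p - shift m p (p + 1)) = d a"
      unfolding 2 d_def gap_def shift_def by simp
    finally show ?thesis using 2 by simp
  next
    case 3
    have "(\<Sum>b=1..<a. ?D b \<star> ((if b = p + 1 then d b \<star> gl a b (?y p) else 0)
         + (if a = p + 1 then gl p b (?y b) else 0) - (if b = p then gl a (p + 1) (?y p) else 0)))
      = (\<Sum>b=1..<a. (if b = p + 1 then (?D (p + 1) * d (p + 1)) \<star> gl a (p + 1) (?y p) else 0))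
      - (\<Sum>b=1..<a. (if b = p then ?D p \<star> gl a (p + 1) (?y p) else 0))"
      unfolding sum_subtractf[symmetric] using 3 by (intro sum.cong refl) (auto simp: scale_right_diff_distrib)
    also have "\<dots> = (?D (p + 1) * d (p + 1)) \<star> gl a (p + 1) (?y p) - ?D p \<star> gl a (p + 1) (?y p)"
      using 3 p by simp
    also have "?D p = ?D (p + 1) * d (p + 1)"
      using 3 by (subst prod.atLeast_Suc_lessThan) (auto simp: mult.commute)
    finally show ?thesis unfolding * using 3 by simp
  qed
qed

text \<open>The other positive root operators are iterated commutators of the simple ones.\<close>

lemma singularI:
  assumes wt: "weight_vec m x" and simple: "\<And>p. 1 \<le> p \<Longrightarrow> p \<le> n \<Longrightarrow> gl p (p + 1) x = 0"
  shows "singular m x"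
proof -
  have "i \<in> idx \<Longrightarrow> i + k + 1 \<in> idx \<Longrightarrow> gl i (i + k + 1) x = 0" for i k
  proof (induction k arbitrary: i)
    case 0
    then show ?case using simple[of i] by auto
  next
    case (Suc k)
    have i: "i + 1 \<in> idx" using Suc.prems by auto
    have "gl i (i + 1) (gl (i + 1) (i + Suc k + 1) x) = gl (i + 1) (i + Suc k + 1) (gl i (i + 1) x)
      + gl i (i + Suc k + 1) x"
      using gl_gl[OF Suc.prems(1) i i Suc.prems(2)] by simp
    moreover have "gl (i + 1) (i + Suc k + 1) x = 0" using Suc.IH[of "i + 1"] Suc.prems by auto
    moreover have "gl i (i + 1) x = 0" using Suc.prems simple[of i] by auto
    ultimately show ?case using Suc.prems i by (simp add: gl_simps)
  qed
  then have "gl i j x = 0" if "i \<in> idx" "j \<in> idx" "i < j" for i j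
    using that less_iff_Suc_add[of i j] by auto
  then show ?thesis using wt by (simp add: singular_def)
qed

text \<open>By the previous lemmas the image under a simple root operator carries the factor $d_s$, and
\<open>gap m s s = 0\<close>.\<close>

lemma singular_raise:
  assumes "singular m u" "s \<in> idx"
  shows "singular (shift m s) (raise (gap m s) s u)"
proof (rule singularI)
  show "weight_vec (shift m s) (raise (gap m s) s u)"
    by (rule weight_vec_raise[OF singular_weight_vec[OF assms(1)] assms(2)])
  fix p assume p: "1 \<le> p" "p \<le> n"
  show "gl p (p + 1) (raise (gap m s) s u) = 0"
    using raise_simple_root[OF assms _ _ p, of s] assms(2) by (simp add: gap_def)
qed

end

section \<open>The maps $\varphi_s$ on singular vectors\<close>

lemma gF_gl_elem: "p \<le> q \<Longrightarrow> gF n p q = gl_elem n (q + 1) p"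
  by (auto simp: gF_def gl_elem_def mat_unit_def intro!: eq_matI)

lemma gE_gl_elem: "p \<le> q \<Longrightarrow> gE n p q = gl_elem n p (q + 1)"
  by (auto simp: gE_def gl_elem_def mat_unit_def intro!: eq_matI)

lemma gH_gl_elem: "gH n i = g_add (gl_elem n i i) (g_scale (-1) (gl_elem n (i + 1) (i + 1)))"
  by (auto simp: gH_def gl_elem_def mat_unit_def g_add_def g_scale_def intro!: eq_matI eq_vecI)

context g_module
begin

lemma act_gH:
  assumes "i \<in> {1..n}"
  shows "act (gH n i) x = gl i i x - gl (i + 1) (i + 1) x"
proof -
  have "i \<in> idx" "i + 1 \<in> idx" using assms by auto
  then have "act (gH n i) x = gl i i x + (-1) \<star> gl (i + 1) (i + 1) x"
    unfolding gH_gl_elem gl_def by (simp only: act_add act_scale g_carrier_scale gl_elem_carrier)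
  then show ?thesis by simp
qed

text \<open>Expanding the traceless part of $A_{1,1}$ by \<open>act_expand\<close> reproduces it together with a multiple of
the sum in question.\<close>

lemma sum_gl_diag: "(\<Sum>i\<in>idx. gl i i x) = 0"
proof -
  let ?X = "fst (gl_elem n 1 1)"
  have "gl_elem n 1 1 \<in> g_carrier n" by (rule gl_elem_carrier) auto
  then have X: "?X \<in> carrier_mat (n + 1) (n + 1)" "(\<Sum>i<n + 1. ?X $$ (i, i)) = 0"
    by (simp_all only: g_carrier_def mem_Collect_eq case_prod_unfold)
  have e: "gl_elem n 1 1 = (?X, 0\<^sub>v (n + 1))" by (simp add: gl_elem_def)
  have entry: "?X $$ (i - 1, j - 1) = (if j = 1 then if i = 1 then 1 else 0 else 0)
      - (if j = i then 1 / of_nat (n + 1) else 0)" if "i \<in> idx" "j \<in> idx" for i j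
    using that by (auto simp: gl_elem_def)
  have "gl 1 1 x = (\<Sum>i\<in>idx. \<Sum>j\<in>idx. ?X $$ (i - 1, j - 1) \<star> gl i j x)
      + (\<Sum>k\<in>idx. 0\<^sub>v (n + 1) $ (k - 1) \<star> pp k x)"
    unfolding gl_def[of 1 1] using act_expand[OF X, of "0\<^sub>v (n + 1)" x] e by simp
  also have "(\<Sum>k\<in>idx. 0\<^sub>v (n + 1) $ (k - 1) \<star> pp k x) = 0"
    by (intro sum.neutral) auto
  also have "(\<Sum>i\<in>idx. \<Sum>j\<in>idx. ?X $$ (i - 1, j - 1) \<star> gl i j x)
      = (\<Sum>i\<in>idx. \<Sum>j\<in>idx. (if j = 1 then if i = 1 then gl 1 1 x else 0 else 0)
          - (if j = i then (1 / of_nat (n + 1)) \<star> gl i i x else 0))"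
    by (intro sum.cong refl, subst entry) (auto simp: scale_left_diff_distrib)
  also have "\<dots> = (\<Sum>i\<in>idx. (if i = 1 then gl 1 1 x else 0) - (1 / of_nat (n + 1)) \<star> gl i i x)"
    unfolding sum_subtractf
    by (intro arg_cong2[where f = "(-)"] sum.cong refl) (simp_all only: sum.delta finite_atLeastAtMost, simp_all)
  also have "\<dots> = gl 1 1 x - (1 / of_nat (n + 1)) \<star> (\<Sum>i\<in>idx. gl i i x)"
    unfolding sum_subtractf scale_sum_right[symmetric] by (simp add: sum.delta del: sum.cl_ivl_Suc)
  finally have "(1 / of_nat (n + 1)) \<star> (\<Sum>i\<in>idx. gl i i x) = 0" by simp
  moreover have "1 / of_nat (n + 1) \<noteq> (0 :: complex)"
    using of_nat_neq_0[of n, where 'a = complex] by simp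
  ultimately show ?thesis by (simp only: scale_eq_0_iff) simp
qed

text \<open>The operators $H_i$ determine the differences of the diagonal ones, and the vanishing of their sum
determines the constant.\<close>

lemma hwv_singular:
  assumes u: "hwv \<mu> u"
  obtains m where "singular m u" "\<And>i. i \<in> {1..n} \<Longrightarrow> \<mu> i = m i - m (i + 1)"
proof -
  \<comment> \<open>eigenvalues relative to the last diagonal operator, and the eigenvalue of the latter\<close>
  define \<sigma> where "\<sigma> i = (\<Sum>k=i..n. \<mu> k)" for i
  define c where "c = - (\<Sum>i\<in>idx. \<sigma> i) / of_nat (n + 1)"
  have diff: "gl i i u - gl (i + 1) (i + 1) u = \<mu> i \<star> u" if "i \<in> {1..n}" for i
    using u that by (simp only: act_gH[OF that, symmetric]) (simp add: hwv_def)
  have diag: "gl i i u = gl (n + 1) (n + 1) u + \<sigma> i \<star> u" if "i \<in> idx" for i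
  proof -
    have "i \<le> n + 1" "1 \<le> i" using that by auto
    then show ?thesis
    proof (induction rule: inc_induct)
      case base
      then show ?case by (simp add: \<sigma>_def)
    next
      case (step k)
      have "\<sigma> k = \<mu> k + \<sigma> (Suc k)" using step.hyps by (simp add: \<sigma>_def sum.atLeast_Suc_atMost)
      moreover have "gl k k u = \<mu> k \<star> u + gl (Suc k) (Suc k) u"
        using diff[of k] step.hyps that by (auto simp: diff_eq_eq)
      ultimately show ?case using step.IH by (simp only: scale_left_distrib add.assoc add.left_commute)
    qed
  qed
  have "(\<Sum>i\<in>idx. gl i i u) = (\<Sum>i\<in>idx. gl (n + 1) (n + 1) u + \<sigma> i \<star> u)"
    by (rule sum.cong[OF refl diag])
  then have "0 = (\<Sum>i\<in>idx. gl (n + 1) (n + 1) u + \<sigma> i \<star> u)"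
    by (simp only: sum_gl_diag)
  also have "\<dots> = of_nat (n + 1) \<star> gl (n + 1) (n + 1) u + (\<Sum>i\<in>idx. \<sigma> i) \<star> u"
    by (simp only: sum.distrib sum_constant_scale card_atLeastAtMost scale_sum_left) simp
  finally have "of_nat (n + 1) \<star> gl (n + 1) (n + 1) u = (of_nat (n + 1) * c) \<star> u"
    using of_nat_neq_0[of n, where 'a = complex] by (simp add: c_def eq_neg_iff_add_eq_0 del: of_nat_Suc sum.cl_ivl_Suc)
  then have top: "gl (n + 1) (n + 1) u = c \<star> u"
    using scale_left_imp_eq[OF of_nat_neq_0[of n], of "gl (n + 1) (n + 1) u" "c \<star> u"]
    unfolding scale_scale Suc_eq_plus1 by blast
  have "singular (\<lambda>i. \<sigma> i + c) u"
  proof (rule singularI)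
    show "weight_vec (\<lambda>i. \<sigma> i + c) u"
      unfolding weight_vec_def
    proof
      fix i assume "i \<in> idx"
      from diag[OF this] show "gl i i u = (\<sigma> i + c) \<star> u"
        unfolding top by (simp add: scale_left_distrib add.commute)
    qed
    fix p assume "1 \<le> p" "p \<le> n"
    then show "gl p (p + 1) u = 0"
      unfolding gl_def gE_gl_elem[OF order_refl, symmetric] using u by (simp add: hwv_def)
  qed
  moreover have "\<mu> i = (\<sigma> i + c) - (\<sigma> (i + 1) + c)" if "i \<in> {1..n}" for i
    using that unfolding \<sigma>_def by (subst sum.atLeast_Suc_atMost) auto
  ultimately show thesis by (rule that)
qed

lemma singular_hwv:
  assumes "singular m u" "u \<noteq> 0"
  shows "hwv (\<lambda>i. if i \<in> {1..n} then m i - m (i + 1) else 0) u"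
  unfolding hwv_def
proof (intro conjI ballI allI impI)
  fix i assume i: "i \<in> {1..n}"
  then have "i \<in> idx" "i + 1 \<in> idx" by auto
  then show "act (gH n i) u = (if i \<in> {1..n} then m i - m (i + 1) else 0) \<star> u"
    using i assms(1) by (simp only: act_gH singular_def weight_vec_def if_True scale_left_diff_distrib)
next
  fix p q assume pq: "1 \<le> p \<and> p \<le> q \<and> q \<le> n"
  then have "act (gE n p q) u = gl p (q + 1) u" by (simp add: gE_gl_elem gl_def)
  then show "act (gE n p q) u = 0" using pq assms(1) by (auto simp: singular_def)
qed (use assms in \<open>auto simp: weights_def\<close>)

lemma mu_coeff_gap:
  assumes "1 \<le> k" "k \<le> s" "s \<le> n + 1" "\<And>i. i \<in> {1..n} \<Longrightarrow> \<mu> i = m i - m (i + 1)"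
  shows "mu_coeff \<mu> k (s - 1) = gap m s k"
proof -
  have "mu_coeff \<mu> k (s - 1) = (\<Sum>i=k..<s. (m (Suc i) - of_nat (Suc i)) - (m i - of_nat i))"
    unfolding mu_coeff_def sum_negf[symmetric] using assms
    by (intro sum.cong) auto
  also have "\<dots> = gap m s k"
    unfolding gap_def using assms(2) by (rule sum_Suc_diff')
  finally show ?thesis .
qed

lemma act_P_mu:
  "act (P_mu n \<mu> s k) v = (\<Prod>q=1..<k. mu_coeff \<mu> q (s - 1)) \<star> pp k v"
  unfolding P_mu_def pp_def by (rule act_scale[OF gP_carrier])

lemma act_F_mu:
  assumes "1 \<le> k" "k \<le> l" "l \<le> n"
  shows "act (F_mu n \<mu> s k l) v = (\<Prod>q=k + 1..l. mu_coeff \<mu> q s) \<star> gl (l + 1) k v"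
  unfolding F_mu_def gl_def gF_gl_elem[OF assms(2)]
  by (rule act_scale[OF gl_elem_carrier]) (use assms in auto)

lemma Q_op_last: "s \<in> idx \<Longrightarrow> Q_op \<mu> (s - 1) s v = v"
  by (subst Q_op.simps) auto

lemma Q_op_step:
  assumes "1 \<le> k" "k < s" "s \<in> idx"
  shows "Q_op \<mu> (s - 1) k v
    = (\<Sum>a=k + 1..s. Q_op \<mu> (s - 1) a ((\<Prod>q=k + 1..<a. mu_coeff \<mu> q (s - 1)) \<star> gl a k v))"
proof -
  have "Q_op \<mu> (s - 1) k v = (\<Sum>l=k..s - 1. Q_op \<mu> (s - 1) (l + 1) (act (F_mu n \<mu> (s - 1) k l) v))"
    using assms by (subst Q_op.simps) auto
  also have "\<dots> = (\<Sum>l=k..s - 1. Q_op \<mu> (s - 1) (l + 1)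
      ((\<Prod>q=k + 1..<l + 1. mu_coeff \<mu> q (s - 1)) \<star> gl (l + 1) k v))"
    using assms by (intro sum.cong refl arg_cong[where f = "Q_op _ _ _"])
      (subst act_F_mu, auto simp: atLeastLessThanSuc_atLeastAtMost)
  also have "\<dots> = (\<Sum>a=k + 1..s. Q_op \<mu> (s - 1) a ((\<Prod>q=k + 1..<a. mu_coeff \<mu> q (s - 1)) \<star> gl a k v))"
    using assms by (intro sum.reindex_bij_witness[of _ "\<lambda>a. a - 1" Suc]) auto
  finally show ?thesis .
qed

lemma lin_Q_op:
  assumes "1 \<le> k" "k \<le> s" "s \<in> idx"
  shows "Vector_Spaces.linear scale scale (Q_op \<mu> (s - 1) k)"
  using assms(2,1)
proof (induction "s - k" arbitrary: k rule: less_induct)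
  case less
  show ?case
  proof (cases "k = s")
    case True
    then show ?thesis using assms(3) by (intro linI) (simp_all only: Q_op_last)
  next
    case False
    then have k: "1 \<le> k" "k < s" using less.prems by auto
    have lin: "Vector_Spaces.linear scale scale (Q_op \<mu> (s - 1) a)"
        "Vector_Spaces.linear scale scale (gl a k)" if "a \<in> {k + 1..s}" for a
      using less.hyps[of a] lin_gl[of a k] that k assms(3) by auto
    let ?f = "\<lambda>a v. Q_op \<mu> (s - 1) a ((\<Prod>q=k + 1..<a. mu_coeff \<mu> q (s - 1)) \<star> gl a k v)"
    have add: "?f a (x + y) = ?f a x + ?f a y" if "a \<in> {k + 1..s}" for a x y
      by (simp only: lin_simps[OF lin(2)[OF that]] scale_right_distrib lin_simps[OF lin(1)[OF that]])
    have scale: "?f a (c \<star> x) = c \<star> ?f a x" if "a \<in> {k + 1..s}" for a c x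
      by (simp only: lin_simps[OF lin(2)[OF that]] scale_left_commute[of _ c] lin_simps[OF lin(1)[OF that]])
    show ?thesis
    proof (rule linI)
      show "Q_op \<mu> (s - 1) k (x + y) = Q_op \<mu> (s - 1) k x + Q_op \<mu> (s - 1) k y" for x y
        unfolding Q_op_step[OF k assms(3)] sum.distrib[symmetric] by (rule sum.cong[OF refl add])
      show "Q_op \<mu> (s - 1) k (c \<star> x) = c \<star> Q_op \<mu> (s - 1) k x" for c x
        unfolding Q_op_step[OF k assms(3)] scale_sum_right by (rule sum.cong[OF refl scale])
    qed
  qed
qed

text \<open>Substituting the recursion of \<open>raise\<close> for the terms $P_k u$ and exchanging the two summations, the
recursion of \<open>Q_op\<close> makes everything telescope except the term at $k = s$.\<close>

lemma Q_op_sum_raise: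
  fixes \<mu> s
  defines "d \<equiv> \<lambda>k. mu_coeff \<mu> k (s - 1)"
  assumes s: "s \<in> idx"
  shows "(\<Sum>k=1..s. Q_op \<mu> (s - 1) k ((\<Prod>q=1..<k. d q) \<star> pp k u)) = raise d s u"
proof -
  let ?Q = "Q_op \<mu> (s - 1)" and ?z = "\<lambda>k. raise d k u"
  let ?g = "\<lambda>b k. ?Q k ((\<Prod>q=b + 1..<k. d q) \<star> gl k b (?z b))"
  have "(\<Sum>k=1..s. ?Q k ((\<Prod>q=1..<k. d q) \<star> pp k u))
     = (\<Sum>k=1..s. ?Q k (?z k) - (\<Sum>b=1..<k. ?g b k))"
  proof (rule sum.cong[OF refl])
    fix k assume k: "k \<in> {1..s}"
    have lin: "Vector_Spaces.linear scale scale (?Q k)" using k s by (intro lin_Q_op) auto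
    have "?Q k (?z k) = ?Q k ((\<Prod>q=1..<k. d q) \<star> pp k u) + (\<Sum>b=1..<k. ?g b k)"
      by (subst raise.simps) (simp only: lin_simps[OF lin])
    then show "?Q k ((\<Prod>q=1..<k. d q) \<star> pp k u) = ?Q k (?z k) - (\<Sum>b=1..<k. ?g b k)" by simp
  qed
  also have "\<dots> = (\<Sum>k=1..s. ?Q k (?z k)) - (\<Sum>k\<in>{1..s}. \<Sum>b\<in>{b \<in> {1..<s}. b < k}. ?g b k)"
    unfolding sum_subtractf
    by (intro arg_cong2[where f = "(-)"] sum.cong refl) auto
  also have "(\<Sum>k\<in>{1..s}. \<Sum>b\<in>{b \<in> {1..<s}. b < k}. ?g b k)
     = (\<Sum>b\<in>{1..<s}. \<Sum>k\<in>{k \<in> {1..s}. b < k}. ?g b k)"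
    by (rule sum.swap_restrict) auto
  also have "\<dots> = (\<Sum>b\<in>{1..<s}. ?Q b (?z b))"
  proof (rule sum.cong[OF refl])
    fix b assume b: "b \<in> {1..<s}"
    have "{k \<in> {1..s}. b < k} = {b + 1..s}" using b by auto
    moreover have "?Q b (?z b) = (\<Sum>k=b + 1..s. ?g b k)"
      unfolding d_def by (rule Q_op_step) (use b s in auto)
    ultimately show "(\<Sum>k\<in>{k \<in> {1..s}. b < k}. ?g b k) = ?Q b (?z b)"
      by (simp only:)
  qed
  also have "(\<Sum>k=1..s. ?Q k (?z k)) = (\<Sum>b\<in>{1..<s}. ?Q b (?z b)) + ?Q s (?z s)"
    using s by (cases s) (auto simp: atLeastLessThanSuc_atLeastAtMost)
  finally show ?thesis using Q_op_last[OF s] by simp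
qed

lemma raise_cong:
  assumes "\<And>k. 1 \<le> k \<Longrightarrow> k < a \<Longrightarrow> d k = d' k"
  shows "raise d a u = raise d' a u"
  using assms
proof (induction a rule: less_induct)
  case (less a)
  have "(\<Prod>k=b..<a. d k) = (\<Prod>k=b..<a. d' k)" if "1 \<le> b" for b
    using less.prems that by (intro prod.cong) auto
  moreover have "raise d b u = raise d' b u" if "b \<in> {1..<a}" for b
    using less.IH[of b] less.prems that by auto
  ultimately show ?case
    unfolding raise.simps[of d a] raise.simps[of d' a] by (auto intro!: sum.cong)
qed

lemma phi_raise:
  assumes u: "singular m u" and s: "s \<in> idx"
  shows "phi s u = raise (gap m s) s u"
proof (cases "u = 0")
  case True
  then show ?thesis by (simp add: phi_def lin_simps[OF lin_raise[OF s]])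
next
  case False
  define \<mu> where "\<mu> = (\<lambda>i. if i \<in> {1..n} then m i - m (i + 1) else 0)"
  have "weight_of u = \<mu>" unfolding \<mu>_def by (rule weight_of_eq[OF singular_hwv[OF u False]])
  then have "phi s u = phi_at \<mu> s u" using False by (simp add: phi_def)
  also have "\<dots> = (\<Sum>k=1..<s. Q_op \<mu> (s - 1) k (act (P_mu n \<mu> s k) u))
      + Q_op \<mu> (s - 1) s (act (P_mu n \<mu> s s) u)"
    unfolding phi_at_def Q_op_last[OF s] by (rule add.commute)
  also have "\<dots> = (\<Sum>k=1..s. Q_op \<mu> (s - 1) k (act (P_mu n \<mu> s k) u))"
    using s by (cases s) (auto simp: atLeastLessThanSuc_atLeastAtMost)
  also have "\<dots> = raise (\<lambda>k. mu_coeff \<mu> k (s - 1)) s u"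
    unfolding act_P_mu by (rule Q_op_sum_raise[OF s])
  also have "\<dots> = raise (gap m s) s u"
    using s by (intro raise_cong mu_coeff_gap) (auto simp: \<mu>_def)
  finally show ?thesis .
qed

lemma singular_phi:
  assumes "singular m u" "s \<in> idx"
  shows "singular (shift m s) (phi s u)"
  unfolding phi_raise[OF assms] by (rule singular_raise[OF assms])

section \<open>Dominance and the Casimir operator\<close>

lemma finite_eigenvalues_module:
  assumes "Vector_Spaces.linear scale scale T"
  shows "finite {r. \<exists>x. x \<noteq> 0 \<and> T x = r \<star> x}"
  using fin_dim finite_eigenvalues[OF assms] by blast

lemma eigenvalue_progression_bounded:
  assumes "Vector_Spaces.linear scale scale T" "c \<noteq> 0"
  obtains K where "\<And>k x. K \<le> k \<Longrightarrow> T x = (r + of_nat k * c) \<star> x \<Longrightarrow> x = 0"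
proof -
  let ?S = "{k. \<exists>x. x \<noteq> 0 \<and> T x = (r + of_nat k * c) \<star> x}"
  have "(\<lambda>k. r + of_nat k * c) ` ?S \<subseteq> {r. \<exists>x. x \<noteq> 0 \<and> T x = r \<star> x}" by auto
  then have "finite ((\<lambda>k. r + of_nat k * c) ` ?S)"
    by (rule finite_subset[OF _ finite_eigenvalues_module[OF assms(1)]])
  moreover have "inj_on (\<lambda>k. r + of_nat k * c) ?S"
    using assms(2) by (auto simp: inj_on_def)
  ultimately have "finite ?S" by (rule finite_imageD)
  then obtain K where K: "\<forall>k\<in>?S. k < K" using finite_nat_set_iff_bounded by blast
  show thesis
  proof (rule that)
    fix k x assume "K \<le> k" "T x = (r + of_nat k * c) \<star> x"
    then show "x = 0" using K[rule_format, of k] by force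
  qed
qed

text \<open>The classical $\mathfrak{sl}(2)$ argument: the powers of the lowering operator applied to $u$ have
distinct eigenvalues under a diagonal operator, so some power vanishes, and applying the raising operator
to the first vanishing one gives $h = k$.\<close>

lemma singular_dominant:
  assumes u: "singular m u" "u \<noteq> 0" and i: "1 \<le> i" "i \<le> n"
  shows "\<exists>k::nat. m i - m (i + 1) = of_nat k"
proof -
  have ii: "i \<in> idx" "i + 1 \<in> idx" using i by auto
  let ?F = "gl (i + 1) i" and ?E = "gl i (i + 1)"
  define x where "x k = (?F ^^ k) u" for k
  define h where "h = m i - m (i + 1)"
  have x_Suc: "x (Suc k) = ?F (x k)" for k by (simp add: x_def)
  have wt: "weight_vec (\<lambda>j. m j + of_nat k * ((if j = i + 1 then 1 else 0) - (if j = i then 1 else 0))) (x k)" for k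
  proof (induction k)
    case 0
    then show ?case using singular_weight_vec[OF u(1)] by (simp add: x_def)
  next
    case (Suc k)
    from weight_vec_gl[OF this ii(2,1)] show ?case
      unfolding x_Suc by (simp add: weight_vec_def algebra_simps)
  qed
  have E: "?E (x (Suc k)) = (of_nat (Suc k) * (h - of_nat k)) \<star> x k" for k
  proof (induction k)
    case 0
    have "?E (x 1) = ?F (?E u) + gl i i u - gl (i + 1) (i + 1) u"
      using gl_gl[OF ii ii(2,1)] by (simp add: x_def)
    also have "\<dots> = (m i - m (i + 1)) \<star> u"
      using u(1) ii by (simp add: singular_def weight_vec_def gl_simps scale_left_diff_distrib)
    finally show ?case by (simp add: h_def x_def)
  next
    case (Suc k)
    let ?y = "x (Suc k)"
    have "?E (x (Suc (Suc k))) = ?F (?E ?y) + gl i i ?y - gl (i + 1) (i + 1) ?y"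
      using gl_gl[OF ii ii(2,1)] by (simp add: x_Suc)
    also have "gl i i ?y = (m i - of_nat (Suc k)) \<star> ?y"
      using weight_vecD[OF wt ii(1), of "Suc k"] by simp
    also have "gl (i + 1) (i + 1) ?y = (m (i + 1) + of_nat (Suc k)) \<star> ?y"
      using weight_vecD[OF wt ii(2), of "Suc k"] by simp
    also have "?F (?E ?y) = (of_nat (Suc k) * (h - of_nat k)) \<star> ?y"
      unfolding Suc.IH using ii by (simp add: lin_simps[OF lin_gl] x_Suc)
    also have "(of_nat (Suc k) * (h - of_nat k)) \<star> ?y + (m i - of_nat (Suc k)) \<star> ?y
        - (m (i + 1) + of_nat (Suc k)) \<star> ?y
      = (of_nat (Suc k) * (h - of_nat k) + (m i - of_nat (Suc k)) - (m (i + 1) + of_nat (Suc k))) \<star> ?y"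
      by (simp only: scale_left_distrib scale_left_diff_distrib)
    also have "of_nat (Suc k) * (h - of_nat k) + (m i - of_nat (Suc k)) - (m (i + 1) + of_nat (Suc k))
      = of_nat (Suc (Suc k)) * (h - of_nat (Suc k))"
      by (simp add: h_def algebra_simps)
    finally show ?case .
  qed
  obtain K where K: "\<And>k y. K \<le> k \<Longrightarrow> gl i i y = (m i + of_nat k * (-1)) \<star> y \<Longrightarrow> y = 0"
    using eigenvalue_progression_bounded[OF lin_gl[OF ii(1,1)], of "-1" "m i"] by auto
  have "x K = 0" using K[of K "x K"] weight_vecD[OF wt ii(1), of K] by simp
  then have "\<exists>k. x (Suc k) = 0 \<and> x k \<noteq> 0"
    using u(2) by (induction K) (auto simp: x_def)
  then obtain k where k: "x (Suc k) = 0" "x k \<noteq> 0" by blast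
  have "(of_nat (Suc k) * (h - of_nat k)) \<star> x k = 0"
    using E[of k] k(1) ii by (simp add: gl_simps)
  then have "h = of_nat k" using k(2) of_nat_neq_0[of k, where 'a = complex]
    by (simp del: of_nat_Suc)
  then show ?thesis unfolding h_def by blast
qed

definition casimir :: "'v \<Rightarrow> 'v" where
  "casimir x = (\<Sum>i\<in>idx. \<Sum>j\<in>idx. gl i j (gl j i x))"

text \<open>The scalar $(m, m + 2\rho)$ by which the Casimir operator acts on a singular vector of weight $m$.\<close>

definition casimir_value :: "(nat \<Rightarrow> complex) \<Rightarrow> complex" where
  "casimir_value m = (\<Sum>i\<in>idx. m i * m i) + (\<Sum>i\<in>idx. of_nat (n + 1) * m i + m i - 2 * of_nat i * m i)"

lemma lin_casimir: "Vector_Spaces.linear scale scale casimir"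
  by (rule linI; unfold casimir_def scale_sum_right sum.distrib[symmetric]; intro sum.cong refl;
      simp only: gl_simps)

text \<open>After reindexing, the four sums of commutator terms cancel in pairs.\<close>

lemma casimir_gl:
  assumes k: "k \<in> idx" and l: "l \<in> idx"
  shows "gl k l (casimir x) = casimir (gl k l x)"
proof -
  have "gl k l (gl i j (gl j i x)) = gl i j (gl j i (gl k l x))
      + ((if l = i then gl k j (gl j i x) else 0) - (if k = j then gl i l (gl j i x) else 0)
       + (if l = j then gl i j (gl k i x) else 0) - (if k = i then gl i j (gl j l x) else 0))"
    if ij: "i \<in> idx" "j \<in> idx" for i j
  proof -
    have "gl k l (gl i j (gl j i x)) = gl i j (gl k l (gl j i x))
      + (if l = i then gl k j (gl j i x) else 0) - (if k = j then gl i l (gl j i x) else 0)"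
      using gl_gl[OF k l ij] by (simp add: eq_commute)
    also have "gl k l (gl j i x) = gl j i (gl k l x) + (if l = j then gl k i x else 0)
      - (if k = i then gl j l x else 0)"
      using gl_gl[OF k l ij(2,1)] by (simp add: eq_commute)
    also have "gl i j \<dots> = gl i j (gl j i (gl k l x)) + (if l = j then gl i j (gl k i x) else 0)
      - (if k = i then gl i j (gl j l x) else 0)"
      by (simp add: lin_simps[OF lin_gl[OF ij]])
    finally show ?thesis by simp
  qed
  then have "gl k l (casimir x) = casimir (gl k l x)
      + (\<Sum>i\<in>idx. \<Sum>j\<in>idx. (if l = i then gl k j (gl j i x) else 0) - (if k = j then gl i l (gl j i x) else 0)
       + (if l = j then gl i j (gl k i x) else 0) - (if k = i then gl i j (gl j l x) else 0))"
    unfolding casimir_def lin_simps[OF lin_gl[OF k l]] sum.distrib[symmetric]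
    by (intro sum.cong refl) simp
  also have "(\<Sum>i\<in>idx. \<Sum>j\<in>idx. (if l = i then gl k j (gl j i x) else 0) - (if k = j then gl i l (gl j i x) else 0)
       + (if l = j then gl i j (gl k i x) else 0) - (if k = i then gl i j (gl j l x) else 0))
     = (\<Sum>i\<in>idx. \<Sum>j\<in>idx. if l = i then gl k j (gl j i x) else 0)
     - (\<Sum>i\<in>idx. \<Sum>j\<in>idx. if k = j then gl i l (gl j i x) else 0)
     + (\<Sum>i\<in>idx. \<Sum>j\<in>idx. if l = j then gl i j (gl k i x) else 0)
     - (\<Sum>i\<in>idx. \<Sum>j\<in>idx. if k = i then gl i j (gl j l x) else 0)"
    by (simp only: sum.distrib sum_subtractf)
  also have "(\<Sum>i\<in>idx. \<Sum>j\<in>idx. if l = i then gl k j (gl j i x) else 0) = (\<Sum>j\<in>idx. gl k j (gl j l x))"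
    by (subst sum.swap) (simp only: sum.delta' finite_atLeastAtMost l if_True)
  also have "(\<Sum>i\<in>idx. \<Sum>j\<in>idx. if k = i then gl i j (gl j l x) else 0) = (\<Sum>j\<in>idx. gl k j (gl j l x))"
    by (subst sum.swap) (simp only: sum.delta' finite_atLeastAtMost k if_True)
  also have "(\<Sum>i\<in>idx. \<Sum>j\<in>idx. if k = j then gl i l (gl j i x) else 0) = (\<Sum>i\<in>idx. gl i l (gl k i x))"
    by (simp only: sum.delta' finite_atLeastAtMost k if_True)
  also have "(\<Sum>i\<in>idx. \<Sum>j\<in>idx. if l = j then gl i j (gl k i x) else 0) = (\<Sum>i\<in>idx. gl i l (gl k i x))"
    by (simp only: sum.delta' finite_atLeastAtMost l if_True)
  finally show ?thesis by simp
qed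

lemma sum_ordered_pairs:
  fixes f :: "nat \<Rightarrow> complex"
  shows "(\<Sum>i\<in>{1..N}. \<Sum>j\<in>{1..N}. if i < j then f i - f j else 0)
    = (\<Sum>i\<in>{1..N}. of_nat N * f i + f i - 2 * of_nat i * f i)"
proof -
  have "(\<Sum>i\<in>{1..N}. \<Sum>j\<in>{1..N}. if i < j then f i - f j else 0)
    = (\<Sum>i\<in>{1..N}. \<Sum>j\<in>{1..N}. if i < j then f i else 0) - (\<Sum>i\<in>{1..N}. \<Sum>j\<in>{1..N}. if i < j then f j else 0)"
    unfolding sum_subtractf[symmetric] by (intro sum.cong refl) auto
  also have "(\<Sum>i\<in>{1..N}. \<Sum>j\<in>{1..N}. if i < j then f j else 0) = (\<Sum>i\<in>{1..N}. \<Sum>j\<in>{1..N}. if j < i then f i else 0)"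
    by (rule sum.swap)
  also have "(\<Sum>i\<in>{1..N}. \<Sum>j\<in>{1..N}. if i < j then f i else 0) = (\<Sum>i\<in>{1..N}. of_nat (N - i) * f i)"
  proof (rule sum.cong[OF refl])
    fix i assume "i \<in> {1..N}"
    then have "{j \<in> {1..N}. i < j} = {i<..N}" by auto
    then show "(\<Sum>j\<in>{1..N}. if i < j then f i else 0) = of_nat (N - i) * f i"
      by (simp add: sum.If_cases Int_def)
  qed
  also have "(\<Sum>i\<in>{1..N}. \<Sum>j\<in>{1..N}. if j < i then f i else 0) = (\<Sum>i\<in>{1..N}. of_nat (i - 1) * f i)"
  proof (rule sum.cong[OF refl])
    fix i assume "i \<in> {1..N}"
    then have "{j \<in> {1..N}. j < i} = {1..<i}" by auto
    then show "(\<Sum>j\<in>{1..N}. if j < i then f i else 0) = of_nat (i - 1) * f i"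
      by (simp add: sum.If_cases Int_def)
  qed
  also have "(\<Sum>i\<in>{1..N}. of_nat (N - i) * f i) - (\<Sum>i\<in>{1..N}. of_nat (i - 1) * f i)
    = (\<Sum>i\<in>{1..N}. of_nat N * f i + f i - 2 * of_nat i * f i)"
    unfolding sum_subtractf[symmetric] by (intro sum.cong refl) (auto simp: of_nat_diff algebra_simps)
  finally show ?thesis .
qed

lemma casimir_weight_vec:
  assumes x: "weight_vec m x"
  shows "casimir x - casimir_value m \<star> x
    = (\<Sum>i\<in>idx. \<Sum>j\<in>idx. if i < j then 2 \<star> gl j i (gl i j x) else 0)"
proof -
  let ?up = "\<Sum>i\<in>idx. \<Sum>j\<in>idx. if i < j then gl j i (gl i j x) else 0"
  have summand: "gl i j (gl j i x) = (if i < j then gl j i (gl i j x) else 0)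
      + ((if i < j then m i - m j else 0) \<star> x
      + ((if j = i then (m i * m i) \<star> x else 0) + (if j < i then gl i j (gl j i x) else 0)))"
    if ij: "i \<in> idx" "j \<in> idx" for i j
  proof -
    consider "i < j" | "i = j" | "j < i" by linarith
    then show ?thesis
    proof cases
      case 1
      then show ?thesis using gl_gl[OF ij ij(2,1), of x] weight_vecD[OF x ij(1)] weight_vecD[OF x ij(2)]
        by (simp add: scale_left_diff_distrib)
    next
      case 2
      then show ?thesis using weight_vecD[OF x ij(1)] lin_simps[OF lin_gl[OF ij]] by simp
    qed auto
  qed
  have "casimir x = (\<Sum>i\<in>idx. \<Sum>j\<in>idx. (if i < j then gl j i (gl i j x) else 0)
      + ((if i < j then m i - m j else 0) \<star> x
      + ((if j = i then (m i * m i) \<star> x else 0) + (if j < i then gl i j (gl j i x) else 0))))"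
    unfolding casimir_def by (rule sum.cong[OF refl], rule sum.cong[OF refl]) (rule summand)
  also have "\<dots> = ?up + ((\<Sum>i\<in>idx. \<Sum>j\<in>idx. if i < j then m i - m j else 0) \<star> x
      + ((\<Sum>i\<in>idx. m i * m i) \<star> x + (\<Sum>i\<in>idx. \<Sum>j\<in>idx. if j < i then gl i j (gl j i x) else 0)))"
    unfolding sum.distrib scale_sum_left
    by (intro arg_cong2[where f = "(+)"] sum.cong refl) (simp only: sum.delta finite_atLeastAtMost if_True)
  also have "(\<Sum>i\<in>idx. \<Sum>j\<in>idx. if j < i then gl i j (gl j i x) else 0) = ?up"
    by (rule sum.swap)
  finally have "casimir x - casimir_value m \<star> x = ?up + ?up"
    unfolding sum_ordered_pairs casimir_value_def scale_left_distrib by simp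
  also have "\<dots> = (\<Sum>i\<in>idx. \<Sum>j\<in>idx. if i < j then 2 \<star> gl j i (gl i j x) else 0)"
    unfolding sum.distrib[symmetric]
    by (intro sum.cong refl) (auto simp: scale_left_distrib[of 1 1, simplified])
  finally show ?thesis .
qed

end

section \<open>Singular vectors below other weight vectors\<close>

lemma abel_sum:
  fixes s :: "nat \<Rightarrow> nat" and t :: "nat \<Rightarrow> complex"
  assumes "s 0 = 0"
  shows "(\<Sum>i\<in>{1..n + 1}. (of_nat (s i) - of_nat (s (i - 1))) * t i)
     = of_nat (s (n + 1)) * t (n + 1) + (\<Sum>i\<in>{1..n}. of_nat (s i) * (t i - t (i + 1)))"
proof (induction n)
  case 0
  then show ?case using assms by simp
next
  case (Suc n)
  have "{1..Suc n + 1} = insert (n + 2) {1..n + 1}" "{1..Suc n} = insert (n + 1) {1..n}" by auto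
  then show ?case using Suc.IH by (simp add: algebra_simps)
qed

context g_module
begin

text \<open>The weight \<open>l\<close> exceeds the dominant weight \<open>m\<close> by the nonzero sum $\beta$ of simple roots with
multiplicities \<open>s\<close>, and $(l, l + 2\rho) - (m, m + 2\rho) = (\beta, \beta) + 2 (m + \rho, \beta) > 0$.
The term $(\beta, \beta)$ makes up for a weight \<open>l\<close> that is not itself dominant, so the comparison
covers the weights of all vectors and not only those of singular ones.\<close>

lemma casimir_value_above:
  fixes s :: "nat \<Rightarrow> nat"
  assumes dom: "\<And>i. i \<in> {1..n} \<Longrightarrow> \<exists>k::nat. m i - m (i + 1) = of_nat k"
    and s: "s 0 = 0" "s (n + 1) = 0" "\<exists>i\<in>{1..n}. s i \<noteq> 0"
    and l: "\<And>i. i \<in> idx \<Longrightarrow> l i = m i + (of_nat (s i) - of_nat (s (i - 1)))"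
  shows "casimir_value l \<noteq> casimir_value m"
proof -
  \<comment> \<open>$\beta$ and $2 (m + \rho)$, the latter up to a constant, in coordinates\<close>
  define d where "d i = (of_nat (s i) - of_nat (s (i - 1)) :: complex)" for i
  define t where "t i = 2 * m i + of_nat (n + 1) + 1 - 2 * of_nat i" for i
  obtain k where k: "\<And>i. i \<in> {1..n} \<Longrightarrow> m i - m (i + 1) = of_nat (k i)" using dom by metis
  have "casimir_value l - casimir_value m = (\<Sum>i\<in>idx. d i * d i + d i * t i)"
    unfolding casimir_value_def sum.distrib[symmetric] sum_subtractf[symmetric]
    by (intro sum.cong refl) (simp add: l d_def t_def algebra_simps)
  also have "\<dots> = (\<Sum>i\<in>idx. d i * d i) + (\<Sum>i\<in>{1..n}. of_nat (s i) * (t i - t (i + 1)))"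
    unfolding sum.distrib d_def using abel_sum[of s t n, OF s(1)] s(2) by simp
  also have "(\<Sum>i\<in>{1..n}. of_nat (s i) * (t i - t (i + 1))) = (\<Sum>i\<in>{1..n}. of_nat (s i * (2 * k i + 2)))"
  proof (intro sum.cong refl)
    fix i assume "i \<in> {1..n}"
    then have "t i - t (i + 1) = of_nat (2 * k i + 2)"
      using k[of i] by (simp add: t_def algebra_simps)
    then show "of_nat (s i) * (t i - t (i + 1)) = of_nat (s i * (2 * k i + 2))"
      by (simp only: of_nat_mult)
  qed
  also have "\<dots> = of_nat (\<Sum>i\<in>{1..n}. s i * (2 * k i + 2))" by simp
  also have "(\<Sum>i\<in>idx. d i * d i) = of_real (\<Sum>i\<in>idx. (real (s i) - real (s (i - 1)))\<^sup>2)"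
    by (simp add: d_def power2_eq_square)
  finally have "casimir_value l - casimir_value m
    = of_real ((\<Sum>i\<in>idx. (real (s i) - real (s (i - 1)))\<^sup>2) + real (\<Sum>i\<in>{1..n}. s i * (2 * k i + 2)))"
    by simp
  moreover have "0 \<le> (\<Sum>i\<in>idx. (real (s i) - real (s (i - 1)))\<^sup>2)"
    by (rule sum_nonneg) simp
  moreover have "0 < (\<Sum>i\<in>{1..n}. s i * (2 * k i + 2))"
  proof -
    obtain i where "i \<in> {1..n}" "s i \<noteq> 0" using s(3) by blast
    then show ?thesis by (intro sum_pos2[of _ i]) auto
  qed
  ultimately have "casimir_value l - casimir_value m \<noteq> 0"
    by (simp only: of_real_eq_0_iff)
  then show ?thesis by simp
qed

lemma away_casimir_gl:
  assumes "away casimir c x" "i \<in> idx" "j \<in> idx"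
  shows "away casimir c (gl i j x)"
  by (rule away_commuting[where T = casimir and S = "gl i j"])
    (rule assms(1) lin_gl[OF assms(2,3)] casimir_gl[OF assms(2,3)])+

text \<open>Up to the scalar \<open>casimir_value l\<close>, the Casimir operator on a weight vector is a sum of terms
$F E x$ with $E$ raising the weight. Induction downwards on the height of the weight above \<open>m\<close>
applies to $E x$, and the heights are bounded because they occur in eigenvalues of a single operator.\<close>

lemma casimir_away_above:
  fixes s :: "nat \<Rightarrow> nat"
  assumes dom: "\<And>i. i \<in> {1..n} \<Longrightarrow> \<exists>k::nat. m i - m (i + 1) = of_nat k"
    and "s 0 = 0" "s (n + 1) = 0" "\<exists>i\<in>{1..n}. s i \<noteq> 0"
    and "weight_vec (\<lambda>i. m i + (of_nat (s i) - of_nat (s (i - 1)))) x"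
  shows "away casimir (casimir_value m) x"
proof -
  \<comment> \<open>this operator has eigenvalue 1 on each simple root, so it measures the height\<close>
  define h where "h x = (\<Sum>i\<in>idx. (- of_nat i) \<star> gl i i x)" for x
  define r where "r = (\<Sum>i\<in>idx. - of_nat i * m i)"
  have lin_h: "Vector_Spaces.linear scale scale h"
    by (rule linI; unfold h_def scale_sum_right sum.distrib[symmetric]; rule sum.cong[OF refl])
      (simp_all only: gl_simps scale_right_distrib scale_left_commute)
  obtain K where K: "\<And>k x. K \<le> k \<Longrightarrow> h x = (r + of_nat k * 1) \<star> x \<Longrightarrow> x = 0"
    using eigenvalue_progression_bounded[OF lin_h one_neq_zero] by blast
  show ?thesis
    using assms(2-5)
  proof (induction "K - (\<Sum>i\<in>{1..n}. s i)" arbitrary: s x rule: less_induct)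
    case less
    let ?l = "\<lambda>i. m i + (of_nat (s i) - of_nat (s (i - 1)))"
    let ?ht = "\<Sum>i\<in>{1..n}. s i"
    note wt = less.prems(4)
    show ?case
    proof (cases "K \<le> ?ht")
      case True
      have "h x = (\<Sum>i\<in>idx. (- of_nat i * ?l i) \<star> x)"
        unfolding h_def using weight_vecD[OF wt] by (intro sum.cong refl) simp
      also have "\<dots> = (\<Sum>i\<in>idx. - of_nat i * m i + (of_nat (s i) - of_nat (s (i - 1))) * (- of_nat i)) \<star> x"
        unfolding scale_sum_left[symmetric] by (intro arg_cong2[where f = scale] sum.cong refl) (simp add: algebra_simps)
      also have "(\<Sum>i\<in>idx. - of_nat i * m i + (of_nat (s i) - of_nat (s (i - 1))) * (- of_nat i)) = r + of_nat ?ht"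
        unfolding sum.distrib r_def abel_sum[of s, OF less.prems(1)] using less.prems(2) by simp
      finally have "h x = (r + of_nat ?ht * 1) \<star> x" by simp
      then have "x = 0" by (rule K[OF True])
      then show ?thesis by (simp add: away_zero)
    next
      case False
      have up: "away casimir (casimir_value m) (gl i j x)" if ij: "i \<in> idx" "j \<in> idx" "i < j" for i j
      proof -
        \<comment> \<open>adding the root of $A_{i,j}$ adds each simple root from $i$ to $j - 1$ once\<close>
        define s' where "s' k = s k + (if i \<le> k \<and> k < j then 1 else 0)" for k
        have "?ht < (\<Sum>k\<in>{1..n}. s' k)"
          using ij by (intro sum_strict_mono_ex1) (auto simp: s'_def intro!: bexI[of _ i])
        then have meas: "K - (\<Sum>k\<in>{1..n}. s' k) < K - ?ht" using False by linarith
        have nz: "\<exists>k\<in>{1..n}. s' k \<noteq> 0" using ij by (intro bexI[of _ i]) (auto simp: s'_def)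
        have s'0: "s' 0 = 0" "s' (n + 1) = 0" using less.prems ij by (auto simp: s'_def)
        have "weight_vec (\<lambda>k. m k + (of_nat (s' k) - of_nat (s' (k - 1)))) (gl i j x)"
          unfolding weight_vec_def
        proof
          fix k assume k: "k \<in> idx"
          have "m k + (of_nat (s' k) - of_nat (s' (k - 1)))
            = ?l k + (if k = i then 1 else 0) - (if k = j then 1 else 0)"
            using k ij by (auto simp: s'_def)
          then show "gl k k (gl i j x) = (m k + (of_nat (s' k) - of_nat (s' (k - 1)))) \<star> gl i j x"
            using weight_vecD[OF weight_vec_gl[OF wt ij(1,2)] k] by (simp only:)
        qed
        from less.hyps[OF meas s'0 nz this] show ?thesis .
      qed
      have "away casimir (casimir_value m) (casimir x - casimir_value ?l \<star> x)"
      proof -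
        have "(if i < j then 2 \<star> gl j i (gl i j x) else 0) \<in> {x. away casimir (casimir_value m) x}"
          if "i \<in> idx" "j \<in> idx" for i j
        proof (cases "i < j")
          case True
          have "gl j i (gl i j x) \<in> {x. away casimir (casimir_value m) x}"
            using away_casimir_gl[OF up[OF that True] that(2,1)] by simp
          then show ?thesis
            using True subspace_scale[OF subspace_away[OF lin_casimir]] by simp
        qed (simp add: away_zero)
        then have "(\<Sum>i\<in>idx. \<Sum>j\<in>idx. if i < j then 2 \<star> gl j i (gl i j x) else 0)
            \<in> {x. away casimir (casimir_value m) x}"
          by (intro subspace_sum subspace_away[OF lin_casimir])
        then show ?thesis unfolding casimir_weight_vec[OF wt] by simp
      qed
      moreover have "casimir_value ?l \<noteq> casimir_value m"
        by (rule casimir_value_above[of m s ?l, OF dom less.prems(1-3)]) simp_all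
      ultimately show ?thesis by (rule away_step)
    qed
  qed
qed

lemma span_weight_vectors:
  assumes G: "\<And>g. g \<in> G \<Longrightarrow> \<exists>l. weight_vec l g" and z: "z \<in> span G" "weight_vec m z"
  shows "z \<in> span {g \<in> G. weight_vec m g}"
proof -
  have "z \<in> span {g \<in> G. \<forall>i\<in>A. gl i i g = m i \<star> g}" if "finite A" "A \<subseteq> idx" for A
    using that
  proof (induction A rule: finite_induct)
    case empty
    then show ?case using z by simp
  next
    case (insert i A)
    let ?B = "{g \<in> G. \<forall>i\<in>A. gl i i g = m i \<star> g}"
    have i: "i \<in> idx" using insert.prems by simp
    have "z \<in> span {b \<in> ?B. gl i i b = m i \<star> b}"
    proof (rule span_eigenvectors[OF lin_gl[OF i i]])
      show "\<exists>e. gl i i b = e \<star> b" if "b \<in> ?B" for b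
        using G[of b] that i by (auto simp: weight_vec_def)
      show "z \<in> span ?B" using insert by simp
      show "gl i i z = m i \<star> z" using z(2) i by (simp add: weight_vec_def)
    qed
    moreover have "{b \<in> ?B. gl i i b = m i \<star> b} = {g \<in> G. \<forall>j\<in>insert i A. gl j j g = m j \<star> g}"
      by auto
    ultimately show ?case by simp
  qed
  from this[of idx] show ?thesis by (simp add: weight_vec_def)
qed

definition nminus :: "'v set" where
  "nminus = span {gl i j x | i j x. i \<in> idx \<and> j \<in> idx \<and> j < i}"

lemma gl_nminus: "i \<in> idx \<Longrightarrow> j \<in> idx \<Longrightarrow> j < i \<Longrightarrow> gl i j x \<in> nminus"
  unfolding nminus_def by (rule span_base) blast

lemma subspace_nminus: "subspace nminus"
  unfolding nminus_def by (rule subspace_span)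

lemma span_linear_image:
  assumes T: "Vector_Spaces.linear scale scale T" and S: "subspace S"
    and B: "\<And>b. b \<in> B \<Longrightarrow> T b \<in> S" and x: "x \<in> span B"
  shows "T x \<in> S"
  using x
proof (induction rule: span_induct_alt)
  case base
  then show ?case using subspace_0[OF S] by (simp add: lin_simps[OF T])
next
  case (step c b y)
  then show ?case
    using subspace_add[OF S subspace_scale[OF S B[of b]]] by (simp add: lin_simps[OF T])
qed

text \<open>In a vector of $\mathfrak{n}^- V$ of weight $m$ all contributions come from weights strictly above
$m$, where the Casimir operator is \<open>away\<close> from its value at $m$. But a singular vector of weight
$m$ is an eigenvector for that value.\<close>

lemma singular_nminus_zero:
  assumes spanned: "span {x. \<exists>l. weight_vec l x} = UNIV" and z: "singular m z" "z \<in> nminus"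
  shows "z = 0"
proof (rule ccontr)
  assume nz: "z \<noteq> 0"
  have dom: "\<exists>k::nat. m i - m (i + 1) = of_nat k" if "i \<in> {1..n}" for i
    using singular_dominant[OF z(1) nz] that by simp
  let ?G = "{gl i j x | i j x. i \<in> idx \<and> j \<in> idx \<and> j < i \<and> (\<exists>l. weight_vec l x)}"
  have "gl i j x \<in> span ?G" if "i \<in> idx" "j \<in> idx" "j < i" for i j x
  proof (rule span_linear_image[OF lin_gl subspace_span])
    show "x \<in> span {x. \<exists>l. weight_vec l x}" using spanned by simp
    show "gl i j b \<in> span ?G" if "b \<in> {x. \<exists>l. weight_vec l x}" for b
      using that \<open>i \<in> idx\<close> \<open>j \<in> idx\<close> \<open>j < i\<close> by (intro span_base) blast
  qed (use that in auto)
  then have "nminus \<subseteq> span ?G" unfolding nminus_def by (intro span_minimal subspace_span) blast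
  then have "z \<in> span {g \<in> ?G. weight_vec m g}"
  proof (intro span_weight_vectors)
    show "\<exists>l. weight_vec l g" if "g \<in> ?G" for g
      using that weight_vec_gl by blast
  qed (use z in \<open>auto simp: singular_def\<close>)
  moreover have "span {g \<in> ?G. weight_vec m g} \<subseteq> {x. away casimir (casimir_value m) x}"
  proof (intro span_minimal subspace_away[OF lin_casimir] subsetI)
    fix g assume "g \<in> {g \<in> ?G. weight_vec m g}"
    then obtain i j x l where g: "g = gl i j x" "i \<in> idx" "j \<in> idx" "j < i" "weight_vec l x" "weight_vec m g" by blast
    show "g \<in> {x. away casimir (casimir_value m) x}"
    proof (cases "g = 0")
      case True
      then show ?thesis by (simp add: away_zero)
    next
      case False
      \<comment> \<open>undoing $A_{i,j}$ with $j < i$ adds each simple root from $j$ to $i - 1$ once\<close>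
      define s :: "nat \<Rightarrow> nat" where "s k = (if j \<le> k \<and> k < i then 1 else 0)" for k
      have "l k = m k + (of_nat (s k) - of_nat (s (k - 1)))" if k: "k \<in> idx" for k
      proof -
        have "l k + (if k = i then 1 else 0) - (if k = j then 1 else 0) = m k"
          using weight_vec_unique[OF weight_vec_gl[OF g(5,2,3)] _ _ k] g(1,6) False by simp
        then have "l k = m k - (if k = i then 1 else 0) + (if k = j then 1 else 0)"
          by (simp add: algebra_simps)
        also have "\<dots> = m k + (of_nat (s k) - of_nat (s (k - 1)))"
          using k g(2-4) by (auto simp: s_def)
        finally show ?thesis .
      qed
      then have "weight_vec (\<lambda>k. m k + (of_nat (s k) - of_nat (s (k - 1)))) x"
        using g(5) by (simp add: weight_vec_def)
      then have "away casimir (casimir_value m) x"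
      proof (rule casimir_away_above[OF _ _ _ _, rotated -1])
        show "\<exists>k::nat. m i - m (i + 1) = of_nat k" if "i \<in> {1..n}" for i
          using dom[OF that] .
        show "\<exists>k\<in>{1..n}. s k \<noteq> 0"
          using g(2-4) by (intro bexI[of _ j]) (auto simp: s_def)
      qed (use g(2-4) in \<open>auto simp: s_def\<close>)
      then show ?thesis
        unfolding g(1) by (simp add: away_casimir_gl[OF _ g(2,3)])
    qed
  qed
  ultimately have "away casimir (casimir_value m) z" by blast
  moreover have "casimir z - casimir_value m \<star> z = 0"
    unfolding casimir_weight_vec[OF singular_weight_vec[OF z(1)]]
    using z(1) by (intro sum.neutral ballI) (auto simp: singular_def gl_simps)
  ultimately show False using away_eigenvector[OF lin_casimir, of "casimir_value m" z] nz by simp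
qed

section \<open>Vectors that generate the module\<close>

text \<open>Cyclicity stated through invariant subspaces, which can be pulled back along an isomorphism without
comparing enveloping algebras.\<close>

definition generates :: "'v \<Rightarrow> bool" where
  "generates v \<longleftrightarrow> (\<forall>S. subspace S \<longrightarrow> (\<forall>x\<in>g_carrier n. \<forall>y\<in>S. act x y \<in> S) \<longrightarrow> v \<in> S \<longrightarrow> S = UNIV)"

lemma generates_closed:
  assumes v: "generates v" "v \<in> S" and S: "subspace S"
    and gl: "\<And>i j y. i \<in> idx \<Longrightarrow> j \<in> idx \<Longrightarrow> y \<in> S \<Longrightarrow> gl i j y \<in> S"
    and pp: "\<And>k y. k \<in> idx \<Longrightarrow> y \<in> S \<Longrightarrow> pp k y \<in> S"
  shows "S = UNIV"
proof -
  have "act x y \<in> S" if x: "x \<in> g_carrier n" and y: "y \<in> S" for x y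
  proof -
    obtain X p where Xp: "x = (X, p)" by fastforce
    show ?thesis
      using x unfolding Xp g_carrier_def
      by (subst act_expand) (auto intro!: subspace_add[OF S] subspace_sum[OF S] subspace_scale[OF S] gl pp y)
  qed
  then show ?thesis using v S unfolding generates_def by blast
qed

lemma cyclic_gen_generates:
  assumes "cyclic_gen v"
  shows "generates v"
  unfolding generates_def
proof (intro allI impI)
  fix S assume S: "subspace S" "\<forall>x\<in>g_carrier n. \<forall>y\<in>S. act x y \<in> S" "v \<in> S"
  have "f \<in> env_ops (g_carrier n) \<Longrightarrow> \<forall>y\<in>S. f y \<in> S" for f
    by (induction rule: env_ops.induct) (use S in \<open>auto intro: subspace_scale subspace_add\<close>)
  then have "{f v | f. f \<in> env_ops (g_carrier n)} \<subseteq> S" using S(3) by auto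
  then show "S = UNIV" using assms unfolding cyclic_gen_def by auto
qed

text \<open>The weight vectors span a submodule.\<close>

lemma generates_weight_vectors:
  assumes "generates v" "weight_vec m v"
  shows "span {x. \<exists>l. weight_vec l x} = UNIV"
proof (rule generates_closed[OF assms(1) _ subspace_span])
  show "v \<in> span {x. \<exists>l. weight_vec l x}" using assms(2) by (intro span_base) auto
  show "gl i j y \<in> span {x. \<exists>l. weight_vec l x}"
    if "i \<in> idx" "j \<in> idx" "y \<in> span {x. \<exists>l. weight_vec l x}" for i j y
    using that(3) by (rule span_linear_image[OF lin_gl subspace_span, rotated -1])
      (use that weight_vec_gl in \<open>blast intro: span_base\<close>)+
  show "pp k y \<in> span {x. \<exists>l. weight_vec l x}"
    if "k \<in> idx" "y \<in> span {x. \<exists>l. weight_vec l x}" for k y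
    using that(2) by (rule span_linear_image[OF lin_pp subspace_span, rotated -1])
      (use that weight_vec_pp in \<open>blast intro: span_base\<close>)+
qed

section \<open>Commutativity of the maps $\varphi_s$\<close>

lemma gl_pp_lower:
  assumes "i \<in> idx" "j \<in> idx" "k \<in> idx" "j < i"
  shows "pp k (gl i j x) = gl i j (pp k x) - (if j = k then pp i x else 0)"
  using gl_pp[OF assms(1-3), of x] assms(4) by auto

text \<open>For $k \ge a$ the operator $P_k$ commutes with all lowering operators $A_{a,b}$, $b < a$, so only the
leading term survives modulo $\mathfrak{n}^- V$.\<close>

lemma pp_raise_above:
  assumes "a \<in> idx" "k \<in> idx" "a \<le> k"
  shows "pp k (raise d a u) - (\<Prod>q=1..<a. d q) \<star> pp k (pp a u) \<in> nminus"
proof -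
  have "pp k (raise d a u) - (\<Prod>q=1..<a. d q) \<star> pp k (pp a u)
    = (\<Sum>b=1..<a. (\<Prod>q=b + 1..<a. d q) \<star> pp k (gl a b (raise d b u)))"
    by (subst raise.simps) (simp only: pp_simps, simp)
  also have "\<dots> = (\<Sum>b=1..<a. (\<Prod>q=b + 1..<a. d q) \<star> gl a b (pp k (raise d b u)))"
    using assms by (intro sum.cong refl) (simp add: gl_pp_lower)
  also have "\<dots> \<in> nminus"
    using assms by (intro subspace_sum subspace_scale subspace_nminus gl_nminus) auto
  finally show ?thesis .
qed

text \<open>For $i < j$ the operator $P_i$ fails to commute only with the term $A_{j,i}$ of the recursion; its
commutator there is $P_j$, which commutes with what is left.\<close>

lemma pp_raise_below:
  assumes "i \<in> idx" "j \<in> idx" "i < j"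
  shows "pp i (raise d j u) - ((\<Prod>q=1..<j. d q) - (\<Prod>q=i + 1..<j. d q) * (\<Prod>q=1..<i. d q)) \<star> pp j (pp i u)
    \<in> nminus"
proof -
  let ?D = "\<lambda>b. \<Prod>q=b + 1..<j. d q"
  have "pp i (raise d j u) = (\<Prod>q=1..<j. d q) \<star> pp i (pp j u) + (\<Sum>b=1..<j. ?D b \<star> pp i (gl j b (raise d b u)))"
    by (subst raise.simps) (simp only: pp_simps)
  also have "(\<Sum>b=1..<j. ?D b \<star> pp i (gl j b (raise d b u)))
     = (\<Sum>b=1..<j. ?D b \<star> gl j b (pp i (raise d b u)) - (if b = i then ?D i \<star> pp j (raise d i u) else 0))"
    using assms by (intro sum.cong refl) (auto simp: gl_pp_lower scale_right_diff_distrib)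
  also have "\<dots> = (\<Sum>b=1..<j. ?D b \<star> gl j b (pp i (raise d b u))) - ?D i \<star> pp j (raise d i u)"
    unfolding sum_subtractf using assms by simp
  finally have "pp i (raise d j u) - ((\<Prod>q=1..<j. d q) - ?D i * (\<Prod>q=1..<i. d q)) \<star> pp j (pp i u)
     = (\<Sum>b=1..<j. ?D b \<star> gl j b (pp i (raise d b u)))
       - ?D i \<star> (pp j (raise d i u) - (\<Prod>q=1..<i. d q) \<star> pp j (pp i u))"
    by (simp add: pp_pp[of i j] scale_left_diff_distrib scale_right_diff_distrib)
  also have "\<dots> \<in> nminus"
    using assms by (intro subspace_diff subspace_sum subspace_scale subspace_nminus gl_nminus pp_raise_above) auto
  finally show ?thesis .
qed

lemma raise_mod_nminus:
  assumes "s \<in> idx"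
  shows "raise d s u - (\<Prod>q=1..<s. d q) \<star> pp s u \<in> nminus"
proof -
  have "raise d s u - (\<Prod>q=1..<s. d q) \<star> pp s u = (\<Sum>b=1..<s. (\<Prod>q=b + 1..<s. d q) \<star> gl s b (raise d b u))"
    by (subst raise.simps) simp
  also have "\<dots> \<in> nminus"
    using assms by (intro subspace_sum subspace_scale subspace_nminus gl_nminus) auto
  finally show ?thesis .
qed

lemma nminus_trans:
  assumes "x - c \<star> y \<in> nminus" "y - e \<star> z \<in> nminus"
  shows "x - (c * e) \<star> z \<in> nminus"
proof -
  have "x - (c * e) \<star> z = (x - c \<star> y) + c \<star> (y - e \<star> z)"
    by (simp add: scale_right_diff_distrib)
  also have "\<dots> \<in> nminus" using assms by (intro subspace_add subspace_scale subspace_nminus)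
  finally show ?thesis .
qed

text \<open>With $d_q$ standing for \<open>gap m j q\<close>, applying $\varphi_j$ first yields the factor
$\prod_{q<j} d_q - \prod_{q<i} d_q \prod_{i<q<j} d_q$ by \<open>pp_raise_below\<close>. Applying it second, the
weight has been raised at $i$, which replaces the factor $d_i$ of $\prod_{q<j} d_q$ by $d_i - 1$. Both
are equal.\<close>

lemma phi_commute_less:
  assumes spanned: "span {x. \<exists>l. weight_vec l x} = UNIV"
    and u: "singular m u" and ij: "i \<in> idx" "j \<in> idx" "i < j"
  shows "phi i (phi j u) = phi j (phi i u)"
proof -
  let ?P1 = "\<Prod>q=1..<i. gap m j q" and ?P2 = "\<Prod>q=i + 1..<j. gap m j q"
  let ?ci = "\<Prod>q=1..<i. gap m i q" and ?g = "gap m j i"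
  have split: "(\<Prod>q=1..<j. f q) = (\<Prod>q=1..<i. f q) * (f i * (\<Prod>q=i + 1..<j. f q))" for f :: "nat \<Rightarrow> complex"
  proof -
    have "(\<Prod>q=1..<j. f q) = (\<Prod>q=1..<i. f q) * (\<Prod>q=i..<j. f q)"
      using ij by (intro prod.atLeastLessThan_concat[symmetric]) auto
    then show ?thesis using ij by (simp add: prod.atLeast_Suc_lessThan)
  qed
  have sj: "singular (shift m j) (phi j u)" and si: "singular (shift m i) (phi i u)"
    using singular_phi[OF u] ij by auto
  have "phi i (phi j u) - (\<Prod>q=1..<i. gap (shift m j) i q) \<star> pp i (phi j u) \<in> nminus"
    unfolding phi_raise[OF sj ij(1)] by (rule raise_mod_nminus[OF ij(1)])
  moreover have "(\<Prod>q=1..<i. gap (shift m j) i q) = ?ci"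
    using ij by (intro prod.cong refl) (auto simp: gap_def shift_def)
  moreover have "pp i (phi j u) - (?P1 * (?g * ?P2) - ?P2 * ?P1) \<star> pp j (pp i u) \<in> nminus"
    unfolding phi_raise[OF u ij(2)] split[symmetric] by (rule pp_raise_below[OF ij])
  ultimately have 1: "phi i (phi j u) - (?ci * (?P1 * (?g * ?P2) - ?P2 * ?P1)) \<star> pp j (pp i u) \<in> nminus"
    using nminus_trans by simp
  have "phi j (phi i u) - (\<Prod>q=1..<j. gap (shift m i) j q) \<star> pp j (phi i u) \<in> nminus"
    unfolding phi_raise[OF si ij(2)] by (rule raise_mod_nminus[OF ij(2)])
  moreover have "(\<Prod>q=1..<j. gap (shift m i) j q) = ?P1 * ((?g - 1) * ?P2)"
    unfolding split using ij
    by (intro arg_cong2[where f = "(*)"] prod.cong refl) (auto simp: gap_def shift_def)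
  moreover have "pp j (phi i u) - ?ci \<star> pp j (pp i u) \<in> nminus"
    unfolding phi_raise[OF u ij(1)] using ij by (intro pp_raise_above) auto
  ultimately have 2: "phi j (phi i u) - (?P1 * ((?g - 1) * ?P2) * ?ci) \<star> pp j (pp i u) \<in> nminus"
    using nminus_trans by simp
  have eq: "?ci * (?P1 * (?g * ?P2) - ?P2 * ?P1) = ?P1 * ((?g - 1) * ?P2) * ?ci"
    by (simp add: algebra_simps)
  have "phi i (phi j u) - phi j (phi i u) \<in> nminus"
    using subspace_diff[OF subspace_nminus 1[unfolded eq] 2] by (simp only: diff_diff_eq2 diff_add_cancel)
  moreover have "singular (shift (shift m j) i) (phi i (phi j u) - phi j (phi i u))"
  proof -
    have "shift (shift m j) i = shift (shift m i) j" by (auto simp: shift_def)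
    then show ?thesis
      using subspace_diff[OF subspace_singular, of "phi i (phi j u)" "shift (shift m j) i" "phi j (phi i u)"]
        singular_phi[OF sj ij(1)] singular_phi[OF si ij(2)] by simp
  qed
  ultimately show ?thesis using singular_nminus_zero[OF spanned] by fastforce
qed

lemma phi_commute:
  assumes "span {x. \<exists>l. weight_vec l x} = UNIV" "singular m u" "i \<in> idx" "j \<in> idx"
  shows "phi i (phi j u) = phi j (phi i u)"
  using phi_commute_less[OF assms(1,2)] assms(3,4) by (cases i j rule: linorder_cases) auto

section \<open>Singular vectors as combinations of words in the $\varphi_s$\<close>

inductive_set phi_orbit :: "'v \<Rightarrow> 'v set" for v where
  orbit_start: "v \<in> phi_orbit v"
| orbit_phi: "b \<in> phi_orbit v \<Longrightarrow> i \<in> idx \<Longrightarrow> phi i b \<in> phi_orbit v"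

inductive_set lowered :: "'v set \<Rightarrow> 'v set" for B where
  lowered_base: "b \<in> B \<Longrightarrow> b \<in> lowered B"
| lowered_gl: "y \<in> lowered B \<Longrightarrow> i \<in> idx \<Longrightarrow> j \<in> idx \<Longrightarrow> j < i \<Longrightarrow> gl i j y \<in> lowered B"

lemma phi_orbit_singular:
  assumes "b \<in> phi_orbit v" "singular m v"
  shows "\<exists>l. singular l b"
  using assms by induction (blast intro: singular_phi)+

lemma raise_in_subspace:
  assumes S: "subspace S" and lower: "\<And>i j y. i \<in> idx \<Longrightarrow> j \<in> idx \<Longrightarrow> j < i \<Longrightarrow> y \<in> S \<Longrightarrow> gl i j y \<in> S"
    and "a \<in> idx" "\<And>q. 1 \<le> q \<Longrightarrow> q \<le> a \<Longrightarrow> pp q u \<in> S"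
  shows "raise d a u \<in> S"
  using assms(3,4)
proof (induction a rule: less_induct)
  case (less a)
  then show ?case
    by (subst raise.simps) (intro subspace_add[OF S] subspace_scale[OF S] subspace_sum[OF S] lower; auto)
qed

text \<open>For dominant $m$ the entries of $m + \rho$ are strictly decreasing.\<close>

lemma gap_nonzero:
  assumes u: "singular m u" "u \<noteq> 0" and q: "1 \<le> q" "q < s" "s \<le> n + 1"
  shows "gap m s q \<noteq> 0"
proof -
  have "s \<le> n + 1 \<Longrightarrow> \<exists>k::nat. m q - m s = of_nat k" if "q \<le> s" for s
    using that
  proof (induction s rule: dec_induct)
    case base
    then show ?case by (auto intro: exI[of _ 0])
  next
    case (step s)
    obtain k where k: "m q - m s = of_nat k" using step by auto
    obtain l where l: "m s - m (s + 1) = of_nat l"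
      using singular_dominant[OF u, of s] step q by auto
    have "m q - m (Suc s) = of_nat (k + l)" using k l by (simp add: algebra_simps)
    then show ?case by blast
  qed
  then obtain k where k: "m q - m s = of_nat k" using q by (metis less_imp_le_nat)
  have "gap m s q = - of_nat (k + (s - q))"
    using k q by (simp add: gap_def of_nat_diff algebra_simps)
  moreover have "k + (s - q) \<noteq> 0" using q by simp
  ultimately show ?thesis by (simp only: neg_equal_0_iff_equal of_nat_eq_0_iff not_False_eq_True)
qed

lemma gl_span_lowered:
  assumes "i \<in> idx" "j \<in> idx" "j < i" "y \<in> span (lowered B)"
  shows "gl i j y \<in> span (lowered B)"
proof (rule span_linear_image[OF lin_gl[OF assms(1,2)] subspace_span _ assms(4)])
  show "gl i j b \<in> span (lowered B)" if "b \<in> lowered B" for b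
    using lowered_gl[OF that assms(1-3)] by (rule span_base)
qed

text \<open>In the formula for $\varphi_s b$ the coefficient of $P_s b$ is nonzero by \<open>gap_nonzero\<close>, and the other
terms are lowerings of $P_q b$ with $q < s$.\<close>

lemma pp_singular_in_span_lowered:
  assumes B: "\<And>b i. b \<in> B \<Longrightarrow> i \<in> idx \<Longrightarrow> phi i b \<in> B"
    and b: "b \<in> B" "singular m b" and s: "s \<in> idx"
  shows "pp s b \<in> span (lowered B)"
proof (cases "b = 0")
  case True
  then show ?thesis by (simp add: pp_simps span_zero)
next
  case False
  let ?S = "span (lowered B)"
  note lower = gl_span_lowered
  from s show ?thesis
  proof (induction s rule: less_induct)
    case (less s)
    let ?d = "gap m s"
    have "(\<Sum>c=1..<s. (\<Prod>k=c + 1..<s. ?d k) \<star> gl s c (raise ?d c b)) \<in> ?S"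
      using less
      by (intro subspace_sum subspace_scale subspace_span lower raise_in_subspace) auto
    moreover have "raise ?d s b \<in> ?S"
      unfolding phi_raise[OF b(2) less.prems, symmetric]
      by (intro span_base lowered_base B b less.prems)
    ultimately have "(\<Prod>k=1..<s. ?d k) \<star> pp s b \<in> ?S"
      using subspace_diff[OF subspace_span] by (fastforce simp: raise.simps[of ?d s])
    then have "inverse (\<Prod>k=1..<s. ?d k) \<star> ((\<Prod>k=1..<s. ?d k) \<star> pp s b) \<in> ?S"
      by (rule span_scale)
    moreover have "(\<Prod>k=1..<s. ?d k) \<noteq> 0"
      using gap_nonzero[OF b(2) False] less.prems by auto
    ultimately show ?case by simp
  qed
qed

text \<open>The span is a submodule: moving an operator past a lowering operator only leaves commutators that
are again operators of the module applied to a shorter word.\<close>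

lemma span_lowered_phi_orbit:
  assumes v: "generates v" "singular m v"
  shows "span (lowered (phi_orbit v)) = UNIV"
proof -
  let ?Y = "lowered (phi_orbit v)"
  let ?S = "span ?Y"
  note lower = gl_span_lowered
  have Y: "(\<forall>i\<in>idx. \<forall>j\<in>idx. gl i j y \<in> ?S) \<and> (\<forall>k\<in>idx. pp k y \<in> ?S)" if "y \<in> ?Y" for y
    using that
  proof induction
    case (lowered_base b)
    then obtain l where l: "singular l b" using phi_orbit_singular v(2) by blast
    have b: "b \<in> ?S" using lowered_base by (intro span_base lowered.lowered_base)
    have "gl i j b \<in> ?S" if "i \<in> idx" "j \<in> idx" for i j
    proof (cases i j rule: linorder_cases)
      case less
      then show ?thesis using l that by (simp add: singular_def span_zero)
    next
      case equal
      then show ?thesis using weight_vecD[OF singular_weight_vec[OF l] that(1)] b by (simp add: span_scale)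
    next
      case greater
      then show ?thesis using lower that b by simp
    qed
    moreover have "pp k b \<in> ?S" if "k \<in> idx" for k
      using pp_singular_in_span_lowered[OF orbit_phi _ l that] lowered_base by simp
    ultimately show ?case by blast
  next
    case (lowered_gl y i j)
    have "gl k l (gl i j y) \<in> ?S" if kl: "k \<in> idx" "l \<in> idx" for k l
      unfolding gl_gl[OF kl lowered_gl(2,3)]
      using lowered_gl kl lower by (auto intro!: span_add span_diff simp: span_zero)
    moreover have "pp k (gl i j y) \<in> ?S" if k: "k \<in> idx" for k
      unfolding gl_pp_lower[OF lowered_gl(2,3) k lowered_gl(4)]
      using lowered_gl k lower by (auto intro!: span_diff simp: span_zero)
    ultimately show ?case by blast
  qed
  show ?thesis
  proof (rule generates_closed[OF v(1) _ subspace_span])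
    show "v \<in> ?S" by (intro span_base lowered_base orbit_start)
    show "gl i j y \<in> ?S" if "i \<in> idx" "j \<in> idx" "y \<in> ?S" for i j y
      using that(3) by (rule span_linear_image[OF lin_gl subspace_span, rotated -1]) (use that Y in auto)
    show "pp k y \<in> ?S" if "k \<in> idx" "y \<in> ?S" for k y
      using that(2) by (rule span_linear_image[OF lin_pp subspace_span, rotated -1]) (use that Y in auto)
  qed
qed

text \<open>Restricted to the weight of \<open>w\<close>, the spanning set consists of elements of the orbit and of elements
of $\mathfrak{n}^- V$. The latter contribute a singular vector, hence nothing.\<close>

lemma singular_in_span_phi_orbit:
  assumes v: "generates v" "singular m v" and w: "singular l w"
  shows "w \<in> span {b \<in> phi_orbit v. singular l b}"
proof -
  let ?Y = "lowered (phi_orbit v)" and ?B = "{b \<in> phi_orbit v. singular l b}"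
  have wts: "\<exists>k. weight_vec k y" if "y \<in> ?Y" for y
    using that by induction (use phi_orbit_singular v(2) singular_weight_vec weight_vec_gl in blast)+
  have "w \<in> span {y \<in> ?Y. weight_vec l y}"
    using span_lowered_phi_orbit[OF v] singular_weight_vec[OF w] by (intro span_weight_vectors wts) auto
  moreover have "{y \<in> ?Y. weight_vec l y} \<subseteq> ?B \<union> nminus"
  proof
    fix y assume y: "y \<in> {y \<in> ?Y. weight_vec l y}"
    then have "y \<in> ?Y" by simp
    then show "y \<in> ?B \<union> nminus"
    proof cases
      case lowered_base
      then have "singular l y" using phi_orbit_singular[OF _ v(2), of y] y by (auto simp: singular_def)
      then show ?thesis using lowered_base by simp
    next
      case (lowered_gl y i j)
      then show ?thesis using gl_nminus by simp
    qed
  qed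
  ultimately have "w \<in> span (?B \<union> nminus)" using span_mono by blast
  then obtain b z where bz: "b \<in> span ?B" "z \<in> span nminus" "w = b + z"
    unfolding span_Un by blast
  have "span ?B \<subseteq> {x. singular l x}" by (intro span_minimal subspace_singular) auto
  then have "singular l b" using bz(1) by blast
  then have "singular l z" using subspace_diff[OF subspace_singular, of w l b] w bz(3) by simp
  moreover have "z \<in> nminus" using bz(2) span_minimal[OF order_refl subspace_nminus] by blast
  ultimately have "z = 0"
    using singular_nminus_zero[OF generates_weight_vectors[OF v(1) singular_weight_vec[OF v(2)]]] by blast
  then show ?thesis using bz by simp
qed

section \<open>Nilpotency of $\mathfrak{p}$ and equality of the weights\<close>

text \<open>The powers of $P_i$ move the eigenvalue of a diagonal operator by multiples of $1 - 1/(n+1)$, which is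
nonzero for $n \ge 1$. The exponent, the number of eigenvalues, is uniform in the vector.\<close>

lemma pp_nilpotent:
  assumes "n \<ge> 1" and spanned: "span {x. \<exists>l. weight_vec l x} = UNIV" and i: "i \<in> idx"
  obtains K where "\<And>x. (pp i ^^ K) x = 0"
proof -
  define R where "R = {r. \<exists>x. x \<noteq> 0 \<and> gl i i x = r \<star> x}"
  define c :: complex where "c = 1 - 1 / of_nat (n + 1)"
  have c: "c \<noteq> 0"
  proof
    assume "c = 0"
    then have "of_nat (n + 1) = (1 :: complex)"
      using of_nat_neq_0[of n, where 'a = complex] by (simp add: c_def field_simps del: of_nat_Suc)
    then show False using \<open>n \<ge> 1\<close> by simp
  qed
  have finR: "finite R" unfolding R_def by (rule finite_eigenvalues_module[OF lin_gl[OF i i]])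
  have lin: "Vector_Spaces.linear scale scale (pp i ^^ k)" for k
    by (induction k) (auto intro!: linI simp: pp_simps lin_simps)
  have wt: "(pp i ^^ card R) x = 0" if x: "weight_vec l x" for x l
  proof (rule ccontr)
    assume nz: "(pp i ^^ card R) x \<noteq> 0"
    have eig: "gl i i ((pp i ^^ k) x) = (l i + of_nat k * c) \<star> (pp i ^^ k) x" for k
    proof (induction k)
      case 0
      then show ?case using weight_vecD[OF x i] by simp
    next
      case (Suc k)
      let ?y = "(pp i ^^ k) x"
      have "gl i i (pp i ?y) = (l i + of_nat k * c) \<star> pp i ?y + pp i ?y - (1 / of_nat (n + 1)) \<star> pp i ?y"
        using gl_pp[OF i i i, of ?y] by (simp add: Suc.IH pp_simps)
      also have "\<dots> = (l i + of_nat k * c + 1 - 1 / of_nat (n + 1)) \<star> pp i ?y"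
        by (simp only: scale_left_distrib scale_left_diff_distrib scale_one)
      also have "l i + of_nat k * c + 1 - 1 / of_nat (n + 1) = l i + of_nat (Suc k) * c"
        by (simp add: c_def algebra_simps add_divide_distrib)
      finally show ?case by simp
    qed
    have "(pp i ^^ k) x \<noteq> 0" if "k \<le> card R" for k
    proof
      assume "(pp i ^^ k) x = 0"
      then have "(pp i ^^ (card R - k)) ((pp i ^^ k) x) = 0" by (simp only: lin_simps[OF lin])
      moreover have "(pp i ^^ (card R - k)) ((pp i ^^ k) x) = (pp i ^^ (card R - k + k)) x"
        by (simp add: funpow_add)
      ultimately show False using nz that by simp
    qed
    then have "(\<lambda>k. l i + of_nat k * c) ` {..card R} \<subseteq> R"
      using eig unfolding R_def by blast
    then have "card ((\<lambda>k. l i + of_nat k * c) ` {..card R}) \<le> card R"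
      by (rule card_mono[OF finR])
    moreover have "card ((\<lambda>k. l i + of_nat k * c) ` {..card R}) = card {..card R}"
      using c by (intro card_image) (auto simp: inj_on_def)
    ultimately show False by simp
  qed
  have "(pp i ^^ card R) x \<in> {0}" for x
    by (rule span_linear_image[OF lin _ _, of "{0}" "{x. \<exists>l. weight_vec l x}"])
      (use wt spanned in \<open>auto simp: subspace_def\<close>)
  then show thesis using that by blast
qed

text \<open>If $V$ were the sum of the images of $P_j, \dots, P_{n+1}$, then the image of $P_j$ could be dropped: by
iteration $V$ is the sum of the image of $P_j^K = 0$ and the images of the others, as the operators
commute. Dropping all of them leaves $V = 0$.\<close>

lemma p_image_proper:
  fixes w :: 'v
  assumes n: "n \<ge> 1" and spanned: "span {x. \<exists>l. weight_vec l x} = UNIV" and w: "w \<noteq> 0"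
  shows "span {pp k x | k x. k \<in> idx} \<noteq> UNIV"
proof
  let ?G = "\<lambda>j. {pp k x | k x. k \<in> {j..n + 1}}"
  assume full: "span {pp k x | k x. k \<in> idx} = UNIV"
  have step: "span (?G (j + 1)) = UNIV" if j: "j \<in> idx" and IH: "span (?G j) = UNIV" for j
  proof -
    let ?U = "span (?G (j + 1))"
    obtain K where K: "\<And>x. (pp j ^^ K) x = 0" using pp_nilpotent[OF n spanned j] by blast
    have stable: "pp j y \<in> ?U" if "y \<in> ?U" for y
    proof (rule span_linear_image[OF lin_pp subspace_span _ that])
      fix b assume "b \<in> ?G (j + 1)"
      then obtain k x where "b = pp k x" "k \<in> {j + 1..n + 1}" by blast
      then have "pp j b = pp k (pp j x)" "k \<in> {j + 1..n + 1}" using pp_pp[of j k x] by auto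
      then show "pp j b \<in> ?U" by (intro span_base) blast
    qed
    have split: "\<exists>y. x - pp j y \<in> ?U" for x
    proof -
      have "x \<in> span (?G j)" using IH by simp
      then show ?thesis
      proof (induction rule: span_induct_alt)
        case base
        show ?case by (rule exI[of _ 0]) (simp add: pp_simps span_zero)
      next
        case (step c b x)
        from step(1) obtain k z where b: "b = pp k z" "k \<in> {j..n + 1}" by blast
        obtain y where y: "x - pp j y \<in> ?U" using step by blast
        show ?case
        proof (cases "k = j")
          case True
          have "c \<star> b + x - pp j (c \<star> z + y) = x - pp j y" using True b by (simp add: pp_simps)
          then show ?thesis using y by (intro exI[of _ "c \<star> z + y"]) (simp only:)
        next
          case False
          then have "k \<in> {j + 1..n + 1}" using b(2) by auto
          then have "b \<in> ?U" using b(1) by (intro span_base CollectI exI conjI)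
          then have "c \<star> b + (x - pp j y) \<in> ?U" using y by (intro span_add span_scale)
          then show ?thesis by (intro exI[of _ y]) (simp add: algebra_simps)
        qed
      qed
    qed
    have iter: "\<exists>y. x - (pp j ^^ k) y \<in> ?U" for x k
    proof (induction k arbitrary: x)
      case 0
      then show ?case by (intro exI[of _ x]) (simp add: span_zero)
    next
      case (Suc k)
      obtain y where y: "x - pp j y \<in> ?U" using split by blast
      obtain z where "y - (pp j ^^ k) z \<in> ?U" using Suc by blast
      then have "pp j (y - (pp j ^^ k) z) \<in> ?U" by (rule stable)
      then have "(x - pp j y) + pp j (y - (pp j ^^ k) z) \<in> ?U" using y by (intro span_add)
      then show ?case by (intro exI[of _ z]) (simp add: pp_simps)
    qed
    have "x \<in> ?U" for x using iter[of x K] K by simp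
    then show ?thesis by blast
  qed
  have "span (?G (k + 1)) = UNIV" if "k \<le> n + 1" for k
    using that
  proof (induction k)
    case 0
    then show ?case using full by simp
  next
    case (Suc k)
    then show ?case using step[of "Suc k"] by simp
  qed
  from this[of "n + 1"] have "w \<in> span (?G (n + 2))" by simp
  moreover have "?G (n + 2) = {}" by auto
  ultimately show False using w by simp
qed

lemma gl_p_image:
  assumes "i \<in> idx" "j \<in> idx" "y \<in> span {pp k x | k x. k \<in> idx}"
  shows "gl i j y \<in> span {pp k x | k x. k \<in> idx}"
proof (rule span_linear_image[OF lin_gl[OF assms(1,2)] subspace_span _ assms(3)])
  let ?S = "span {pp k x | k x. k \<in> idx}"
  have pp: "pp k x \<in> ?S" if "k \<in> idx" for k x using that by (intro span_base) blast
  fix b assume "b \<in> {pp k x | k x. k \<in> idx}"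
  then obtain k x where b: "b = pp k x" "k \<in> idx" by blast
  show "gl i j b \<in> ?S"
    unfolding b(1) gl_pp[OF assms(1,2) b(2)]
    using pp[OF b(2)] pp[OF assms(1)] by (auto intro!: span_add span_diff span_scale simp: span_zero)
qed

lemma phi_orbit_in_p_image:
  assumes v: "singular m v" and b: "b \<in> phi_orbit v"
  shows "b = v \<or> b \<in> span {pp k x | k x. k \<in> idx}"
  using b
proof cases
  case orbit_start
  then show ?thesis by simp
next
  case (orbit_phi c i)
  let ?S = "span {pp k x | k x. k \<in> idx}"
  obtain l where l: "singular l c" using phi_orbit_singular[OF orbit_phi(2) v] by blast
  have pp: "pp k x \<in> ?S" if "k \<in> idx" for k x using that by (intro span_base) blast
  have "raise (gap l i) i c \<in> ?S"
  proof (rule raise_in_subspace[OF subspace_span _ orbit_phi(3)])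
    show "pp q c \<in> ?S" if "1 \<le> q" "q \<le> i" for q using that orbit_phi(3) by (intro pp) auto
    show "gl a e y \<in> ?S" if ae: "a \<in> idx" "e \<in> idx" "e < a" and y: "y \<in> ?S" for a e y
      by (rule gl_p_image[OF ae(1,2) y])
  qed
  then show ?thesis using orbit_phi(1) phi_raise[OF l orbit_phi(3)] by simp
qed

text \<open>The generator \<open>v\<close> is the only element of its orbit that may lie outside $\mathfrak{p}V$. If the weights
differ, it has the wrong weight to contribute to \<open>w\<close>, so \<open>w\<close> lies in the proper submodule
$\mathfrak{p}V$.\<close>

lemma generators_same_weight:
  assumes n: "n \<ge> 1" and v: "generates v" "singular m v" "v \<noteq> 0" and w: "generates w" "singular l w" "w \<noteq> 0"
    and i: "i \<in> idx"
  shows "m i = l i"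
proof (rule ccontr)
  assume ne: "m i \<noteq> l i"
  let ?S = "span {pp k x | k x. k \<in> idx}"
  have "{b \<in> phi_orbit v. singular l b} \<subseteq> ?S"
    using phi_orbit_in_p_image[OF v(2)] weight_vec_unique[OF singular_weight_vec[OF v(2)] singular_weight_vec v(3) i] ne by blast
  then have "w \<in> ?S"
    using singular_in_span_phi_orbit[OF v(1,2) w(2)] span_minimal[OF _ subspace_span] by blast
  then have "?S = UNIV"
  proof (rule generates_closed[OF w(1) _ subspace_span])
    show "pp k y \<in> ?S" if "k \<in> idx" for k y using that by (intro span_base) blast
  qed (rule gl_p_image)
  then show False
    using p_image_proper[OF n generates_weight_vectors[OF v(1) singular_weight_vec[OF v(2)]] w(3)] by simp
qed

section \<open>Independence of the generator\<close>

lemma phi_linear_on_singular: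
  assumes "s \<in> idx" "singular m x"
  shows "singular m y \<Longrightarrow> phi s (x + y) = phi s x + phi s y" and "phi s (c \<star> x) = c \<star> phi s x"
proof -
  have "singular m (c \<star> x)" using subspace_scale[OF subspace_singular] assms by simp
  then show "phi s (c \<star> x) = c \<star> phi s x"
    using assms by (simp only: phi_raise lin_simps[OF lin_raise])
  assume y: "singular m y"
  then have "singular m (x + y)" using subspace_add[OF subspace_singular] assms by simp
  then show "phi s (x + y) = phi s x + phi s y"
    using assms y by (simp only: phi_raise lin_simps[OF lin_raise])
qed

lemma phi_zero [simp]: "phi s 0 = 0"
  by (simp add: phi_def)

lemma subspace_fold_phi_kernel:
  assumes "set L \<subseteq> idx"
  shows "subspace {x. singular m x \<and> fold phi L x = 0}"
proof -
  have "fold phi L 0 = 0" by (induction L) auto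
  moreover have "singular m x \<Longrightarrow> singular m y \<Longrightarrow> fold phi L (x + y) = fold phi L x + fold phi L y" for x y
    using assms
  proof (induction L arbitrary: x y m)
    case (Cons s L)
    then have s: "s \<in> idx" "set L \<subseteq> idx" by auto
    show ?case
      using Cons.IH[OF singular_phi[OF Cons.prems(1) s(1)] singular_phi[OF Cons.prems(2) s(1)] s(2)]
        phi_linear_on_singular(1)[OF s(1) Cons.prems(1,2)] by simp
  qed simp
  moreover have "singular m x \<Longrightarrow> fold phi L (c \<star> x) = c \<star> fold phi L x" for x c
    using assms
  proof (induction L arbitrary: x m)
    case (Cons s L)
    then have s: "s \<in> idx" "set L \<subseteq> idx" by auto
    show ?case
      using Cons.IH[OF singular_phi[OF Cons.prems(1) s(1)] s(2)]
        phi_linear_on_singular(2)[OF s(1) Cons.prems(1)] by simp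
  qed simp
  ultimately show ?thesis
    using subspace_add[OF subspace_singular] subspace_scale[OF subspace_singular] subspace_0[OF subspace_singular]
    by (intro subspaceI) auto
qed

lemma fold_phi_commute:
  assumes "span {x. \<exists>l. weight_vec l x} = UNIV" "singular m b" "i \<in> idx" "set L \<subseteq> idx"
  shows "fold phi L (phi i b) = phi i (fold phi L b)"
  using assms(2,4)
proof (induction L arbitrary: m b)
  case (Cons j L)
  then have j: "j \<in> idx" "set L \<subseteq> idx" by auto
  show ?case
    using Cons.IH[OF singular_phi[OF Cons.prems(1) j(1)] j(2)]
      phi_commute[OF assms(1) Cons.prems(1) assms(3) j(1)] by simp
qed simp

text \<open>By commutativity a word that kills \<open>v\<close> kills its whole orbit, and \<open>w\<close> is a linear combination of
elements of the orbit that have the same weight, on which the word acts linearly.\<close>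

lemma fold_phi_vanishing:
  assumes v: "generates v" "singular m v" and w: "singular m w" and L: "set L \<subseteq> idx"
    and zero: "fold phi L v = 0"
  shows "fold phi L w = 0"
proof -
  have orbit: "fold phi L b = 0" if "b \<in> phi_orbit v" for b
    using that
  proof induction
    case (orbit_phi b i)
    obtain l where "singular l b" using phi_orbit_singular[OF orbit_phi(1) v(2)] by blast
    from fold_phi_commute[OF generates_weight_vectors[OF v(1) singular_weight_vec[OF v(2)]] this orbit_phi(2) L]
    show ?case using orbit_phi by simp
  qed (rule zero)
  have "span {b \<in> phi_orbit v. singular m b} \<subseteq> {x. singular m x \<and> fold phi L x = 0}"
    using orbit by (intro span_minimal subspace_fold_phi_kernel[OF L]) auto
  then show ?thesis using singular_in_span_phi_orbit[OF v w] by blast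
qed

lemma phi_word_append: "phi_word k (xs @ [J]) v = (phi (k + length xs) ^^ J) (phi_word k xs v)"
  by (induction xs arbitrary: k v) auto

lemma phi_word_fold:
  "\<exists>L. set L \<subseteq> {k..<k + length xs} \<and> (\<forall>v. phi_word k xs v = fold phi L v)"
proof (induction xs arbitrary: k)
  case Nil
  show ?case by (intro exI[of _ "[]"]) simp
next
  case (Cons i xs)
  obtain L where L: "set L \<subseteq> {k + 1..<k + 1 + length xs}" "\<forall>v. phi_word (k + 1) xs v = fold phi L v"
    using Cons by blast
  have "(phi k ^^ i) v = fold phi (replicate i k) v" for v
    by (induction i arbitrary: v) (simp_all add: funpow_swap1)
  then show ?case using L by (intro exI[of _ "replicate i k @ L"]) auto
qed

text \<open>One more application of $\varphi$ after a word is again a word, longer by one entry; this is why words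
of length up to $n + 1$ occur.\<close>

lemma J_set_eqI:
  assumes "\<And>xs. length xs \<le> n + 1 \<Longrightarrow> phi_word 1 xs v = 0 \<longleftrightarrow> phi_word 1 xs w = 0"
  shows "J_set \<mu> v = J_set \<mu> w"
proof -
  have num: "J_num v xs = J_num w xs" if "length xs \<le> n" for xs
    using assms[of "xs @ [_]"] that unfolding J_num_def phi_word_append by (simp add: add.commute)
  then have "J_index v = J_index w" unfolding J_index_def by auto
  moreover have "J_num v xs = J_num w xs" if "xs \<in> J_index w" for xs
    using that num by (simp add: J_index_def)
  ultimately show ?thesis unfolding J_set_def by auto
qed

lemma J_set_generator:
  assumes n: "n \<ge> 1" and v: "generates v" "hwv \<mu> v" and w: "generates w" "hwv \<nu> w"
  shows "J_set \<mu> v = J_set \<nu> w"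
proof -
  obtain m where m: "singular m v" "\<And>i. i \<in> {1..n} \<Longrightarrow> \<mu> i = m i - m (i + 1)"
    using hwv_singular[OF v(2)] by blast
  obtain l where l: "singular l w" "\<And>i. i \<in> {1..n} \<Longrightarrow> \<nu> i = l i - l (i + 1)"
    using hwv_singular[OF w(2)] by blast
  have nz: "v \<noteq> 0" "w \<noteq> 0" using v w by (auto simp: hwv_def)
  have ml: "m i = l i" if "i \<in> idx" for i
    by (rule generators_same_weight[OF n v(1) m(1) nz(1) w(1) l(1) nz(2) that])
  have "\<mu> i = \<nu> i" for i
  proof (cases "i \<in> {1..n}")
    case True
    then show ?thesis using m(2) l(2) ml[of i] ml[of "i + 1"] by auto
  next
    case False
    then show ?thesis using v(2) w(2) by (auto simp: hwv_def weights_def)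
  qed
  then have "\<mu> = \<nu>" by blast
  moreover have "singular m w" using l(1) ml by (auto simp: singular_def weight_vec_def)
  then have "J_set \<nu> v = J_set \<nu> w"
  proof (intro J_set_eqI)
    fix xs :: "nat list" assume "length xs \<le> n + 1"
    then obtain L where "set L \<subseteq> idx" "\<forall>v. phi_word 1 xs v = fold phi L v"
      using phi_word_fold[of 1 xs] by fastforce
    then show "phi_word 1 xs v = 0 \<longleftrightarrow> phi_word 1 xs w = 0"
      using fold_phi_vanishing[OF v(1) m(1) \<open>singular m w\<close>] fold_phi_vanishing[OF w(1) \<open>singular m w\<close> m(1)] by auto
  qed
  ultimately show ?thesis by simp
qed

end

section \<open>Transport along an isomorphism\<close>

locale g_module_iso = V: g_module scaleV n actV + W: g_module scaleW n actW
  for scaleV :: "complex \<Rightarrow> 'v::ab_group_add \<Rightarrow> 'v" and n and actV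
    and scaleW :: "complex \<Rightarrow> 'w::ab_group_add \<Rightarrow> 'w" and actW +
  fixes T :: "'v \<Rightarrow> 'w"
  assumes linear_T: "Vector_Spaces.linear scaleV scaleW T"
    and bij_T: "bij T"
    and T_act: "x \<in> g_carrier n \<Longrightarrow> T (actV x v) = actW x (T v)"
begin

sublocale T: Vector_Spaces.linear scaleV scaleW T by (rule linear_T)

lemma T_eq_iff: "T x = T y \<longleftrightarrow> x = y"
  using bij_is_inj[OF bij_T] by (simp add: inj_eq)

lemma T_eq_zero_iff: "T x = 0 \<longleftrightarrow> x = 0"
  using T_eq_iff[of x 0] by (simp add: T.zero)

lemma hwv_T: "W.hwv \<mu> (T v) \<longleftrightarrow> V.hwv \<mu> v"
proof -
  have H: "actW (gH n i) (T v) = scaleW (\<mu> i) (T v) \<longleftrightarrow> actV (gH n i) v = scaleV (\<mu> i) v"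
    if "i \<in> {1..n}" for i
  proof -
    have "gH n i \<in> g_carrier n"
      unfolding gH_gl_elem using that
      by (intro V.g_carrier_add V.g_carrier_scale gl_elem_carrier) auto
    then show ?thesis by (simp add: T_act[symmetric] T.scale[symmetric] T_eq_iff)
  qed
  have E: "actW (gE n p q) (T v) = 0 \<longleftrightarrow> actV (gE n p q) v = 0" if "1 \<le> p" "p \<le> q" "q \<le> n" for p q
    using that by (simp add: gE_gl_elem T_act[symmetric] gl_elem_carrier T_eq_zero_iff)
  show ?thesis
    unfolding W.hwv_def V.hwv_def T_eq_zero_iff using H E by auto
qed

lemma weight_of_T: "W.weight_of (T v) = V.weight_of v"
  unfolding W.weight_of_def V.weight_of_def hwv_T ..

lemma P_mu_carrier: "P_mu n \<mu> s k \<in> g_carrier n"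
  unfolding P_mu_def by (rule V.g_carrier_scale[OF gP_carrier])

lemma Q_op_T:
  assumes "1 \<le> k" "s \<le> n"
  shows "W.Q_op \<mu> s k (T v) = T (V.Q_op \<mu> s k v)"
  using assms
proof (induction \<mu> s k arbitrary: v rule: V.Q_op.induct)
  case (1 \<mu> s k)
  show ?case
  proof (cases "k > s")
    case True
    then show ?thesis by (simp add: V.Q_op.simps[of \<mu> s k] W.Q_op.simps[of \<mu> s k])
  next
    case False
    have "W.Q_op \<mu> s (l + 1) (actW (F_mu n \<mu> s k l) (T v)) = T (V.Q_op \<mu> s (l + 1) (actV (F_mu n \<mu> s k l) v))"
      if l: "l \<in> {k..s}" for l
    proof -
      have "F_mu n \<mu> s k l \<in> g_carrier n"
        unfolding F_mu_def using l 1 gF_gl_elem[of k l n]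
        by (auto intro!: V.g_carrier_scale gl_elem_carrier)
      then show ?thesis using 1(1)[OF False l] 1(3) by (simp add: T_act[symmetric])
    qed
    then show ?thesis using False
      by (simp add: V.Q_op.simps[of \<mu> s k] W.Q_op.simps[of \<mu> s k] T.sum)
  qed
qed

lemma phi_T:
  assumes "i \<le> n + 1"
  shows "W.phi i (T v) = T (V.phi i v)"
  unfolding V.phi_def W.phi_def T_eq_zero_iff weight_of_T V.phi_at_def W.phi_at_def
  using assms by (auto simp: T.zero T.add T.sum T_act[OF P_mu_carrier, symmetric] Q_op_T intro!: sum.cong)

lemma phi_word_T:
  assumes "k + length xs \<le> n + 2"
  shows "W.phi_word k xs (T v) = T (V.phi_word k xs v)"
  using assms
proof (induction xs arbitrary: k v)
  case (Cons i xs)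
  have "(W.phi k ^^ j) (T v) = T ((V.phi k ^^ j) v)" for j
    by (induction j) (use Cons.prems in \<open>simp_all add: phi_T\<close>)
  then show ?case using Cons by simp
qed simp

lemma J_set_T: "W.J_set \<mu> (T v) = V.J_set \<mu> v"
proof -
  have num: "W.J_num (T v) xs = V.J_num v xs" if "length xs \<le> n" for xs
  proof -
    have "(W.phi (length xs + 1) ^^ J) (W.phi_word 1 xs (T v)) = T ((V.phi (length xs + 1) ^^ J) (V.phi_word 1 xs v))" for J
      using phi_word_T[of 1 "xs @ [J]" v] that
      unfolding V.phi_word_append W.phi_word_append by (simp add: add.commute)
    then show ?thesis unfolding W.J_num_def V.J_num_def by (simp add: T_eq_zero_iff)
  qed
  then have "W.J_index (T v) = V.J_index v" unfolding W.J_index_def V.J_index_def by auto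
  moreover have "W.J_num (T v) xs = V.J_num v xs" if "xs \<in> V.J_index v" for xs
    using that num by (simp add: V.J_index_def)
  ultimately show ?thesis unfolding W.J_set_def V.J_set_def by auto
qed

lemma generates_T:
  assumes "V.generates v"
  shows "W.generates (T v)"
  unfolding W.generates_def
proof (intro allI impI)
  fix S assume S: "W.subspace S" "\<forall>x\<in>g_carrier n. \<forall>y\<in>S. actW x y \<in> S" "T v \<in> S"
  have "V.subspace (T -` S)"
    by (rule T.subspace_vimage[OF S(1)])
  moreover have "\<forall>x\<in>g_carrier n. \<forall>y\<in>T -` S. actV x y \<in> T -` S" using S(2) by (simp add: T_act)
  ultimately have "T -` S = UNIV" using assms S(3) unfolding V.generates_def by blast
  moreover have "\<exists>x. y = T x" for y using surjD[OF bij_is_surj[OF bij_T]] by blast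
  ultimately show "S = UNIV" by (metis UNIV_eq_I UNIV_I vimage_eq)
qed

end

theorem theorem3p27:
  fixes n :: nat
    and scaleV :: "complex \<Rightarrow> 'v::ab_group_add \<Rightarrow> 'v" and actV :: "gelem \<Rightarrow> 'v \<Rightarrow> 'v"
    and scaleW :: "complex \<Rightarrow> 'w::ab_group_add \<Rightarrow> 'w" and actW :: "gelem \<Rightarrow> 'w \<Rightarrow> 'w"
    and v :: 'v and w :: 'w and \<mu>0 \<nu>0 :: "nat \<Rightarrow> complex"
  assumes "n \<ge> 1"
    and "g_module scaleV n actV"
    and "g_module scaleW n actW"
    and "g_module.hwv scaleV n actV \<mu>0 v"
    and "g_module.hwv scaleW n actW \<nu>0 w"
    and "g_module.cyclic_gen scaleV n actV v"
    and "g_module.cyclic_gen scaleW n actW w"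
    and "g_module_equiv n scaleV actV scaleW actW"
  shows "g_module.J_set scaleV n actV \<mu>0 v = g_module.J_set scaleW n actW \<nu>0 w"
proof -
  obtain T where T: "Vector_Spaces.linear scaleV scaleW T" "bij T"
    "\<And>x u. x \<in> g_carrier n \<Longrightarrow> T (actV x u) = actW x (T u)"
    using assms(8) unfolding g_module_equiv_def by blast
  interpret g_module_iso scaleV n actV scaleW actW T
    by (intro g_module_iso.intro g_module_iso_axioms.intro assms(2,3) T)
  have "V.J_set \<mu>0 v = W.J_set \<mu>0 (T v)" by (rule J_set_T[symmetric])
  also have "\<dots> = W.J_set \<nu>0 w"
  proof (rule W.J_set_generator[OF assms(1)])
    show "W.generates (T v)" by (rule generates_T[OF V.cyclic_gen_generates[OF assms(6)]])
    show "W.hwv \<mu>0 (T v)" using assms(4) by (simp add: hwv_T)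
  qed (use assms(5,7) W.cyclic_gen_generates in auto)
  finally show ?thesis .
qed

end
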